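(* Let $\varphi:\mathbb{R}^n\to\overline{\mathbb{R}}$ be a proper, lower semicontinuous and weakly convex function. For $(x,v)\in\operatorname{gph}\partial\varphi$, say that $(D\partial\varphi)(x,v)$ is positive semidefinite if $\langle z,w\rangle\ge 0$ for all $w\in\mathbb{R}^n$ and all $z\in(D\partial\varphi)(x,v)(w)$. Then the following assertions are equivalent: (i) $\varphi$ is convex. (ii) For all $(x,v)\in\operatorname{gph}\partial\varphi$, $(D\partial\varphi)(x,v)$ is positive semidefinite. (iii) For all $(x,v)\in\operatorname{gph}\partial\varphi$ such that $\varphi$ is twice epi-differentiable at $x$ for $v$, $(D\partial\varphi)(x,v)$ is positive semidefinite. (iv) For all $(x,v)\in\operatorname{gph}\partial\varphi$ such that $\varphi$ is generalized twice differentiable at $x$ for $v$, $(D\partial\varphi)(x,v)$ is positive semidefinite.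
   Context: $\overline{\mathbb{R}}:=\mathbb{R}\cup\{\infty\}=(-\infty,\infty]$; $\mathbb{R}^n$ carries the Euclidean norm $\|\cdot\|$ and inner product $\langle\cdot,\cdot\rangle$. For $\varphi:\mathbb{R}^n\to\overline{\mathbb{R}}$, $\operatorname{dom}\varphi=\{x\mid\varphi(x)<\infty\}$ and $\operatorname{epi}\varphi=\{(x,\alpha)\in\mathbb{R}^{n+1}\mid\alpha\ge\varphi(x)\}$; $\varphi$ is proper if $\operatorname{dom}\varphi\neq\emptyset$. For $s\in\mathbb{R}$, $\varphi$ is $s$-convex if $\varphi((1-\lambda)x+\lambda y)\le(1-\lambda)\varphi(x)+\lambda\varphi(y)-\frac{s}{2}\lambda(1-\lambda)\|x-y\|^2$ for all $x,y\in\mathbb{R}^n$, $\lambda\in(0,1)$. It is convex if this holds with $s=0$, and weakly convex if it holds for some $s<0$. For $\Omega\subset\mathbb{R}^s$ and $\bar z\in\Omega$: the tangent (contingent) cone is $T_\Omega(\bar z)=\{w\mid\exists\,t_k\downarrow 0,\ w_k\to w,\ \bar z+t_kw_k\in\Omega\}$; the regular normal cone is $\widehat N_\Omega(\bar z)=\{v\mid\limsup_{z\to\bar z,\,z\in\Omega}\langle v,z-\bar z\rangle/\|z-\bar z\|\le 0\}$; the limiting normal cone is $N_\Omega(\bar z)=\{v\mid\exists\,z_k\to\bar z,\ z_k\in\Omega,\ v_k\to v,\ v_k\in\widehat N_\Omega(z_k)\}$. The limiting subdifferential of $\varphi$ at $x\in\operatorname{dom}\varphi$ is $\partial\varphi(x)=\{v\mid(v,-1)\in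 N_{\operatorname{epi}\varphi}(x,\varphi(x))\}$ (and $\partial\varphi(x)=\emptyset$ if $x\notin\operatorname{dom}\varphi$); $\operatorname{gph}\partial\varphi=\{(x,v)\mid v\in\partial\varphi(x)\}$. The subgradient graphical derivative at $(x,v)\in\operatorname{gph}\partial\varphi$ is $(D\partial\varphi)(x,v)(w)=\{z\in\mathbb{R}^n\mid(w,z)\in T_{\operatorname{gph}\partial\varphi}(x,v)\}$. For $(x,v)\in\operatorname{gph}\partial\varphi$ and $\tau>0$, put $\Delta^2_\tau\varphi(x,v)(u)=\dfrac{\varphi(x+\tau u)-\varphi(x)-\tau\langle v,u\rangle}{\frac12\tau^2}$. The second subderivative is $d^2\varphi(x,v)(w)=\liminf_{\tau\downarrow 0,\,u\to w}\Delta^2_\tau\varphi(x,v)(u)$, which may take extended-real values. $\varphi$ is twice epi-differentiable at $x$ for $v$ if for every $w\in\mathbb{R}^n$ and every sequence $\tau_k\downarrow 0$ there is a sequence $w^k\to w$ with $\Delta^2_{\tau_k}\varphi(x,v)(w^k)\to d^2\varphi(x,v)(w)$. A generalized quadratic form is a function of the form $w\mapsto\langle w,Aw\rangle+\delta_L(w)$, where $A\in\mathbb{R}^{n\times n}$ is symmetric, $L\subset\mathbb{R}^n$ is a linear subspace, and $\delta_L$ is $0$ on $L$ and $\infty$ elsewhere. $\varphi$ is generalized twice differentiable at $x$ for $v\in\partial\varphi(x)$ if it is twice epi-differentiable at $x$ for $v$ and $d^2\varphi(x,v)$ is a generalized quadratic form. *)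

theory Defs
  imports "HOL-Analysis.Analysis"
begin

(* Functions into (-\<infinity>, \<infinity>] have type 'a \<Rightarrow> ereal; that -\<infinity> is not a value is
   a separate hypothesis wherever it is needed.  "t_k \<down> 0" is read as: t_k > 0 for all k
   and t_k \<longlonglongrightarrow> 0. *)

definition eff_dom :: "('a \<Rightarrow> ereal) \<Rightarrow> 'a set" where
  "eff_dom \<phi> = {x. \<phi> x < \<infinity>}"

definition epi :: "('a \<Rightarrow> ereal) \<Rightarrow> ('a \<times> real) set" where
  "epi \<phi> = {(x, \<alpha>). ereal \<alpha> \<ge> \<phi> x}"

definition proper_fun :: "('a \<Rightarrow> ereal) \<Rightarrow> bool" where
  "proper_fun \<phi> \<longleftrightarrow> eff_dom \<phi> \<noteq> {}"

definition lower_semicontinuous :: "('a::topological_space \<Rightarrow> ereal) \<Rightarrow> bool" where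
  "lower_semicontinuous \<phi> \<longleftrightarrow> (\<forall>x. \<phi> x \<le> Liminf (at x) \<phi>)"

definition s_convex :: "real \<Rightarrow> ('a::euclidean_space \<Rightarrow> ereal) \<Rightarrow> bool" where
  "s_convex s \<phi> \<longleftrightarrow>
     (\<forall>x y. \<forall>l\<in>{0<..<1}.
        \<phi> ((1 - l) *\<^sub>R x + l *\<^sub>R y)
          \<le> ereal (1 - l) * \<phi> x + ereal l * \<phi> y
             - ereal (s / 2 * l * (1 - l) * (norm (x - y))\<^sup>2))"

definition convex_fun :: "('a::euclidean_space \<Rightarrow> ereal) \<Rightarrow> bool" where
  "convex_fun \<phi> \<longleftrightarrow> s_convex 0 \<phi>"

definition weakly_convex :: "('a::euclidean_space \<Rightarrow> ereal) \<Rightarrow> bool" where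
  "weakly_convex \<phi> \<longleftrightarrow> (\<exists>s<0. s_convex s \<phi>)"

definition tangent_cone :: "'a::euclidean_space set \<Rightarrow> 'a \<Rightarrow> 'a set" where
  "tangent_cone \<Omega> z =
     {w. \<exists>(t :: nat \<Rightarrow> real) w'.
           (\<forall>k. 0 < t k) \<and> t \<longlonglongrightarrow> 0 \<and> w' \<longlonglongrightarrow> w \<and> (\<forall>k. z + t k *\<^sub>R w' k \<in> \<Omega>)}"

(* The filter "at z within \<Omega>" omits z itself; at an isolated point of \<Omega> it is trivial,
   the Limsup is -\<infinity>, and every v is a regular normal. *)
definition regular_normal_cone :: "'a::euclidean_space set \<Rightarrow> 'a \<Rightarrow> 'a set" where
  "regular_normal_cone \<Omega> z =
     {v. Limsup (at z within \<Omega>) (\<lambda>y. ereal (v \<bullet> (y - z) / norm (y - z))) \<le> 0}"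

definition limiting_normal_cone :: "'a::euclidean_space set \<Rightarrow> 'a \<Rightarrow> 'a set" where
  "limiting_normal_cone \<Omega> z =
     {v. \<exists>z' v'. z' \<longlonglongrightarrow> z \<and> (\<forall>k. z' k \<in> \<Omega>) \<and> v' \<longlonglongrightarrow> v \<and>
           (\<forall>k. v' k \<in> regular_normal_cone \<Omega> (z' k))}"

(* real_of_ereal is faithful here: \<phi> x < \<infinity>, and \<phi> does not take the value -\<infinity>. *)
definition subdifferential :: "('a::euclidean_space \<Rightarrow> ereal) \<Rightarrow> 'a \<Rightarrow> 'a set" where
  "subdifferential \<phi> x =
     {v. x \<in> eff_dom \<phi> \<and> (v, -1) \<in> limiting_normal_cone (epi \<phi>) (x, real_of_ereal (\<phi> x))}"

definition gph_subdiff :: "('a::euclidean_space \<Rightarrow> ereal) \<Rightarrow> ('a \<times> 'a) set" where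
  "gph_subdiff \<phi> = {(x, v). v \<in> subdifferential \<phi> x}"

definition graphical_derivative ::
    "('a::euclidean_space \<Rightarrow> ereal) \<Rightarrow> 'a \<Rightarrow> 'a \<Rightarrow> 'a \<Rightarrow> 'a set" where
  "graphical_derivative \<phi> x v w = {z. (w, z) \<in> tangent_cone (gph_subdiff \<phi>) (x, v)}"

definition pos_semidef_map :: "('a::euclidean_space \<Rightarrow> 'a set) \<Rightarrow> bool" where
  "pos_semidef_map D \<longleftrightarrow> (\<forall>w. \<forall>z\<in>D w. z \<bullet> w \<ge> 0)"

definition second_quotient ::
    "('a::euclidean_space \<Rightarrow> ereal) \<Rightarrow> 'a \<Rightarrow> 'a \<Rightarrow> real \<Rightarrow> 'a \<Rightarrow> ereal" where
  "second_quotient \<phi> x v \<tau> u =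
     (\<phi> (x + \<tau> *\<^sub>R u) - \<phi> x - ereal (\<tau> * (v \<bullet> u))) / ereal (1 / 2 * \<tau>\<^sup>2)"

(* In the lower limit u is allowed to equal w, hence nhds w rather than at w. *)
definition second_subderivative ::
    "('a::euclidean_space \<Rightarrow> ereal) \<Rightarrow> 'a \<Rightarrow> 'a \<Rightarrow> 'a \<Rightarrow> ereal" where
  "second_subderivative \<phi> x v w =
     Liminf (at_right 0 \<times>\<^sub>F nhds w) (\<lambda>(\<tau>, u). second_quotient \<phi> x v \<tau> u)"

definition twice_epi_differentiable ::
    "('a::euclidean_space \<Rightarrow> ereal) \<Rightarrow> 'a \<Rightarrow> 'a \<Rightarrow> bool" where
  "twice_epi_differentiable \<phi> x v \<longleftrightarrow>
     (\<forall>w. \<forall>\<tau> :: nat \<Rightarrow> real. (\<forall>k. 0 < \<tau> k) \<and> \<tau> \<longlonglongrightarrow> 0 \<longrightarrow>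
        (\<exists>w'. w' \<longlonglongrightarrow> w \<and>
           (\<lambda>k. second_quotient \<phi> x v (\<tau> k) (w' k)) \<longlonglongrightarrow> second_subderivative \<phi> x v w))"

definition indicator_fun :: "'a set \<Rightarrow> 'a \<Rightarrow> ereal" where
  "indicator_fun L w = (if w \<in> L then 0 else \<infinity>)"

definition generalized_quadratic_form :: "(real ^ 'n \<Rightarrow> ereal) \<Rightarrow> bool" where
  "generalized_quadratic_form q \<longleftrightarrow>
     (\<exists>(A :: real ^ 'n ^ 'n) L. transpose A = A \<and> subspace L \<and>
        q = (\<lambda>w. ereal (w \<bullet> (A *v w)) + indicator_fun L w))"

definition generalized_twice_differentiable ::
    "(real ^ 'n \<Rightarrow> ereal) \<Rightarrow> real ^ 'n \<Rightarrow> real ^ 'n \<Rightarrow> bool" where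
  "generalized_twice_differentiable \<phi> x v \<longleftrightarrow>
     twice_epi_differentiable \<phi> x v \<and> generalized_quadratic_form (second_subderivative \<phi> x v)"

end

theory Submission
  imports Defs
begin

text \<open>Only (iv) \<open>\<Longrightarrow>\<close> (i) is substantial. If \<^term>\<open>\<phi>\<close> is s-convex and r + s > 0, the proximal map P with
  parameter r is single-valued and Lipschitz, so it is differentiable almost everywhere by
  Rademacher's theorem. At a point z where P has derivative B, the second-order expansion of the
  Moreau envelope shows that \<^term>\<open>\<phi>\<close> is generalized twice differentiable at x = P z for
  v = r (z - P z), and (B h, r (h - B h)) is tangent to the graph of the subdifferential at (x, v).
  Positive semidefiniteness therefore gives |B h|^2 \<le> <B h, h>, hence |B h| \<le> |h|, for almost every z.
  Integrating along lines, the gradient r (z - P z) of the envelope is monotone. So every Moreau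
  envelope with r > -s is convex, and letting r tend to infinity \<^term>\<open>\<phi>\<close> is convex.

  For Rademacher's theorem, Radon-Nikodym gives one-sided derivatives in dimension one, Fubini gives one-sided directional derivatives almost everywhere, and their
  linearity comes from density points (the argument of Nekvinda and Zajicek).\<close>

section \<open>Rademacher's theorem\<close>

text \<open>The obstacle is that the points x where \<open>\<phi>\<close> behaves well may form a
  null set; even its domain may be one. The Lipschitz map z -> (P z, r (z - P z)) takes the whole
  space into the graph of the subdifferential, so "almost every" makes sense in terms of z although
  it would be empty in terms of x. No second-order smoothness of \<open>\<phi>\<close> is available
  either, so its quotients are compared with those of the envelope. If P has derivative B at z, then
  for every h the number r (|h|^2 - <B h, h>) - r |w - h|^2 is a lower bound for the second
  subderivative at w, with equality when w = B h. This family and its equality case yield the value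
  r (<B h, h> - |B h|^2) on the range of B, the value infinity off it, and the symmetry of B; the
  curve realizing equality gives the recovery sequences of epi-differentiability. Weak convexity
  enters through the modulus s + r > 0 of the penalized function, on which the existence and the
  Lipschitz constant of P rest.\<close>

text \<open>The pullback of Lebesgue measure under the homeomorphism F is absolutely continuous because
  Lipschitz images of null sets are null; the derivative is its Radon-Nikodym density.\<close>

lemma expanding_Lipschitz_has_integral_derivative:
  fixes F :: "real \<Rightarrow> real"
  assumes lo: "\<And>x y. x \<le> y \<Longrightarrow> y - x \<le> F y - F x"
    and hi: "\<And>x y. x \<le> y \<Longrightarrow> F y - F x \<le> C * (y - x)"
  obtains D where "\<And>a b. a \<le> b \<Longrightarrow> (D has_integral F b - F a) {a..b}"
proof -
  have ex: "\<bar>F x - F y\<bar> \<ge> \<bar>x - y\<bar>" "\<bar>F x - F y\<bar> \<le> C * \<bar>x - y\<bar>" for x y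
    using lo[of x y] lo[of y x] hi[of x y] hi[of y x] by (cases "x \<le> y"; force)+
  have lip: "C-lipschitz_on UNIV F"
    using hi[of 0 1] lo[of 0 1] ex(2) by (auto simp: lipschitz_on_def dist_real_def)
  have contF: "continuous_on UNIV F"
    using lip by (rule lipschitz_on_continuous_on)
  have smono: "x < y \<Longrightarrow> F x < F y" for x y
    using lo[of x y] by auto
  have le_iff: "F x \<le> F y \<longleftrightarrow> x \<le> y" for x y
    using smono[of x y] smono[of y x] by (cases x y rule: linorder_cases) auto
  have inj: "inj F"
    by (rule injI) (metis le_iff order_antisym order_refl)
  have surj: "\<exists>x. F x = y" for y
  proof -
    let ?R = "\<bar>y - F 0\<bar>"
    have "F (- ?R) \<le> y" "y \<le> F ?R"
      using lo[of "- ?R" 0] lo[of 0 ?R] by auto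
    then have "\<exists>x\<ge>-?R. x \<le> ?R \<and> F x = y"
      by (intro IVT') (use contF continuous_on_subset in auto)
    then show ?thesis by blast
  qed
  define G where "G = inv F"
  have FG: "F (G y) = y" for y
    using surj by (metis G_def f_inv_into_f rangeI)
  have GF: "G (F x) = x" for x
    by (simp add: G_def inj)
  have "1-lipschitz_on UNIV G"
    using ex(1)[of "G _" "G _"] by (auto simp: lipschitz_on_def dist_real_def FG)
  then have "continuous_on UNIV G"
    by (rule lipschitz_on_continuous_on)
  then have G_meas [measurable]: "G \<in> borel_measurable borel"
    by (rule borel_measurable_continuous_onI)
  have vim: "G -` A = F ` A" for A
    using FG GF by (auto simp: image_iff intro: sym)
  define M where "M = distr lborel borel G"
  have em: "emeasure M A = emeasure lborel (F ` A)" if "A \<in> sets borel" for A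
    unfolding M_def using that by (subst emeasure_distr) (auto simp: vim)
  have ac: "absolutely_continuous lborel M"
    unfolding absolutely_continuous_def
  proof
    fix A :: "real set" assume A: "A \<in> null_sets lborel"
    then have "negligible A"
      by (simp add: negligible_iff_null_sets null_sets_completionI)
    then have "negligible (F ` A)"
      by (rule negligible_locally_Lipschitz_image[rotated])
        (use ex(2) in \<open>auto intro!: exI[of _ UNIV] exI[of _ C]\<close>)
    moreover have "F ` A \<in> sets borel"
    proof -
      have "G -` A \<inter> space borel \<in> sets borel"
        using A by (intro measurable_sets[OF G_meas]) auto
      then show ?thesis by (simp add: vim)
    qed
    ultimately have "emeasure lborel (F ` A) = 0"
      by (simp add: negligible_iff_emeasure0)
    then show "A \<in> null_sets M"
      using A em by (auto simp: null_sets_def M_def)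
  qed
  obtain f where f: "f \<in> borel_measurable lborel" "density lborel f = M"
    using sigma_finite_measure.Radon_Nikodym[OF sigma_finite_lborel ac] by (auto simp: M_def)
  have int: "(\<integral>\<^sup>+x. f x * indicator {a..b} x \<partial>lborel) = ennreal (F b - F a)" if "a \<le> b" for a b
  proof -
    have "F ` {a..b} = {F a..F b}"
    proof (intro equalityI subsetI)
      fix y assume "y \<in> {F a..F b}"
      then have "G y \<in> {a..b}"
        using le_iff[of a "G y"] le_iff[of "G y" b] by (simp add: FG)
      then show "y \<in> F ` {a..b}"
        using FG[of y] by (metis imageI)
    qed (auto simp: le_iff)
    then have "emeasure M {a..b} = ennreal (F b - F a)"
      using that by (simp add: em le_iff)
    then show ?thesis
      using f(1) unfolding f(2)[symmetric] by (simp add: emeasure_density)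
  qed
  \<comment> \<open>\<open>enn2real\<close> sends infinity to 0, so D represents the density only
    where f is finite. Almost every point is of this kind because M is finite on each
    [-n, n].\<close>
  have fin: "AE x in lborel. f x \<noteq> \<infinity>"
  proof -
    have "AE x in lborel. \<forall>n::nat. f x * indicator {-real n..real n} x \<noteq> \<infinity>"
    proof (subst AE_all_countable, intro allI nn_integral_noteq_infinite)
      fix n
      show "(\<lambda>x. f x * indicator {- real n..real n} x) \<in> borel_measurable lborel"
        using f(1) by simp
      show "(\<integral>\<^sup>+ x. f x * indicator {- real n..real n} x \<partial>lborel) \<noteq> \<infinity>"
        by (subst int) auto
    qed
    then show ?thesis
    proof (rule AE_mp, intro AE_I2 impI)
      fix x assume *: "\<forall>n::nat. f x * indicator {-real n..real n} x \<noteq> \<infinity>"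
      obtain n :: nat where "\<bar>x\<bar> \<le> real n"
        using real_arch_simple by blast
      then have "x \<in> {-real n..real n}" by auto
      then show "f x \<noteq> \<infinity>"
        using *[rule_format, of n] by simp
    qed
  qed
  define D where "D x = enn2real (f x)" for x
  have "(D has_integral F b - F a) {a..b}" if "a \<le> b" for a b
  proof -
    have Dm: "D \<in> borel_measurable borel"
      using f(1) by (simp add: D_def[abs_def])
    have "((\<lambda>x. D x * indicator {a..b} x) has_integral F b - F a) UNIV"
    proof (rule nn_integral_has_integral)
      show "(\<lambda>x. D x * indicator {a..b} x) \<in> borel_measurable borel"
        using Dm by simp
      have "(\<integral>\<^sup>+x. ennreal (D x * indicator {a..b} x) \<partial>lborel) = (\<integral>\<^sup>+x. f x * indicator {a..b} x \<partial>lborel)"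
        using fin by (intro nn_integral_cong_AE) (auto simp: D_def indicator_def less_top)
      then show "(\<integral>\<^sup>+x. ennreal (D x * indicator {a..b} x) \<partial>lborel) = ennreal (F b - F a)"
        using int[OF that] by simp
    qed (use that in \<open>auto simp: D_def le_iff\<close>)
    then show ?thesis
      by (subst has_integral_restrict_UNIV[symmetric])
        (simp add: indicator_def of_bool_def if_distrib cong: if_cong)
  qed
  then show thesis using that by blast
qed

text \<open>Adding (L + 1) x to g makes all slopes lie between 1 and 2 L + 1, so the previous lemma
  applies; subtracting L + 1 from the density undoes the shift. The limit is one-sided because the
  differentiation theorem used averages over intervals starting at x.\<close>

lemma Lipschitz_right_derivative:
  fixes g :: "real \<Rightarrow> real"
  assumes lip: "\<And>x y. \<bar>g x - g y\<bar> \<le> L * \<bar>x - y\<bar>"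
  obtains D N where "negligible N"
    "\<And>a b. a \<le> b \<Longrightarrow> (D has_integral g b - g a) {a..b}"
    "\<And>x. x \<notin> N \<Longrightarrow> ((\<lambda>t. (g (x + t) - g x) / t) \<longlongrightarrow> D x) (at_right 0)"
proof -
  define F where "F x = g x + (L + 1) * x" for x
  have "y - x \<le> F y - F x" "F y - F x \<le> (2 * L + 1) * (y - x)" if "x \<le> y" for x y
    using lip[of y x] that by (auto simp: F_def algebra_simps abs_le_iff)
  then obtain E where E: "\<And>a b. a \<le> b \<Longrightarrow> (E has_integral F b - F a) {a..b}"
    using expanding_Lipschitz_has_integral_derivative by blast
  define D where "D x = E x - (L + 1)" for x
  have D: "(D has_integral g b - g a) {a..b}" if "a \<le> b" for a b
  proof -
    have "(D has_integral (F b - F a) - (b - a) *\<^sub>R (L + 1)) {a..b}"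
      unfolding D_def using E[OF that] has_integral_const_real[of "L + 1" a b] that
      by (intro has_integral_diff) (auto simp: content_real)
    then show ?thesis by (simp add: F_def algebra_simps)
  qed
  have int: "D integrable_on cbox a b" for a b
    by (cases "a \<le> b") (use D in \<open>auto simp: integrable_on_def box_real intro: exI[of _ "0::real"]\<close>)
  then obtain N where N: "negligible N" and lim: "\<And>x e. \<lbrakk>x \<notin> N; 0 < e\<rbrakk> \<Longrightarrow>
     \<exists>d>0. \<forall>h. 0 < h \<and> h < d \<longrightarrow>
        norm(integral (cbox x (x + h *\<^sub>R One)) D /\<^sub>R h ^ DIM(real) - D x) < e"
    using integrable_ccontinuous_explicit[of D] by metis
  have "((\<lambda>t. (g (x + t) - g x) / t) \<longlongrightarrow> D x) (at_right 0)" if "x \<notin> N" for x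
  proof (rule tendstoI)
    fix e :: real assume "0 < e"
    from lim[OF that this] obtain d where d: "d > 0" "\<And>h. 0 < h \<Longrightarrow> h < d \<Longrightarrow>
        norm(integral (cbox x (x + h *\<^sub>R One)) D /\<^sub>R h ^ DIM(real) - D x) < e" by blast
    have "dist ((g (x + h) - g x) / h) (D x) < e" if "0 < h" "h < d" for h
    proof -
      have "integral {x..x + h} D = g (x + h) - g x"
        using D[of x "x + h"] that by (intro integral_unique) auto
      then show ?thesis
        using d(2)[OF that] by (simp add: dist_real_def divide_inverse_commute)
    qed
    then show "\<forall>\<^sub>F h in at_right 0. dist ((g (x + h) - g x) / h) (D x) < e"
      using d(1) eventually_at_right_field by blast
  qed
  with N D that show thesis by blast
qed

section \<open>Null sets along parallel lines\<close>

lemma AE_lborel_line_swap: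
  fixes v :: "'a::euclidean_space"
  assumes "S \<in> sets borel"
  shows "(AE x in lborel. AE t in lborel. x + t *\<^sub>R v \<in> S)
     \<longleftrightarrow> (AE t in lborel. AE x in lborel. x + t *\<^sub>R v \<in> S)"
proof -
  have pair: "pair_sigma_finite (lborel :: 'a measure) (lborel :: real measure)"
    by (simp add: pair_sigma_finite_def sigma_finite_lborel)
  have "(\<lambda>z :: 'a \<times> real. fst z + snd z *\<^sub>R v) -` S \<inter> space (borel :: ('a \<times> real) measure) \<in> sets borel"
    by (intro measurable_sets[OF borel_measurable_continuous_onI] assms continuous_intros)
  then have "{z \<in> space (lborel \<Otimes>\<^sub>M lborel). fst z + snd z *\<^sub>R v \<in> S} \<in> sets (lborel \<Otimes>\<^sub>M lborel)"
    unfolding lborel_prod by (simp add: vimage_def)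
  then show ?thesis
    by (rule pair_sigma_finite.AE_commute[OF pair])
qed

lemma AE_lborel_translation:
  fixes c :: "'a::euclidean_space"
  assumes "S \<in> sets borel"
  shows "(AE x in lborel. x + c \<in> S) \<longleftrightarrow> (AE x in lborel. x \<in> S)"
proof -
  have "(AE x in distr lborel borel ((+) c). x \<in> S) \<longleftrightarrow> (AE x in lborel. c + x \<in> S)"
    using assms by (intro AE_distr_iff) auto
  then show ?thesis unfolding lborel_distr_plus by (simp add: add.commute)
qed

text \<open>After exchanging the two quantifiers by Fubini, the condition for fixed t is a translate
  of S and so does not depend on t; the remaining quantifier over t is constant.\<close>

lemma AE_lborel_lines:
  fixes v :: "'a::euclidean_space"
  assumes "S \<in> sets borel"
  shows "(AE x in lborel. AE t in lborel. x + t *\<^sub>R v \<in> S) \<longleftrightarrow> (AE x in lborel. x \<in> S)"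
  by (simp add: AE_lborel_line_swap AE_lborel_translation assms eventually_const_iff ae_filter_eq_bot_iff)

lemma AE_lborel_iff_negligible:
  fixes P :: "'a::euclidean_space \<Rightarrow> bool"
  shows "(AE x in lborel. P x) \<longleftrightarrow> negligible {x. \<not> P x}"
  by (auto simp: eventually_ae_filter negligible_iff_null_sets null_sets_completion_iff2)

section \<open>One-sided directional derivatives\<close>

definition has_right_derivative :: "('a::real_normed_vector \<Rightarrow> real) \<Rightarrow> 'a \<Rightarrow> 'a \<Rightarrow> real \<Rightarrow> bool" where
  "has_right_derivative f x v l \<longleftrightarrow> ((\<lambda>t. (f (x + t *\<^sub>R v) - f x) / t) \<longlongrightarrow> l) (at_right 0)"

lemma has_right_derivativeD:
  assumes "has_right_derivative f x v l" "e > 0"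
  obtains d where "d > 0" "\<And>t. 0 < t \<Longrightarrow> t < d \<Longrightarrow> \<bar>f (x + t *\<^sub>R v) - f x - t * l\<bar> \<le> e * t"
proof -
  from assms have "\<forall>\<^sub>F t in at_right 0. dist ((f (x + t *\<^sub>R v) - f x) / t) l < e"
    by (auto simp: has_right_derivative_def dest: tendstoD)
  then obtain d where d: "d > 0" "\<And>t. 0 < t \<Longrightarrow> t < d \<Longrightarrow> \<bar>(f (x + t *\<^sub>R v) - f x) / t - l\<bar> < e"
    unfolding eventually_at_right_field dist_real_def by blast
  have "\<bar>f (x + t *\<^sub>R v) - f x - t * l\<bar> \<le> e * t" if "0 < t" "t < d" for t
  proof -
    have "\<bar>f (x + t *\<^sub>R v) - f x - t * l\<bar> = \<bar>(f (x + t *\<^sub>R v) - f x) / t - l\<bar> * t"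
      using that by (simp add: field_simps flip: abs_mult_pos')
    also have "\<dots> \<le> e * t"
      using d(2)[OF that] that by (intro mult_right_mono) auto
    finally show ?thesis .
  qed
  with d(1) that show thesis by blast
qed

text \<open>Cauchy's criterion with tolerances and radii of the form 1 / Suc k. It removes the
  unknown limit and leaves countable quantifiers over k and n, from which measurability can be read
  off.\<close>

lemma right_derivative_exists_iff:
  fixes f :: "'a::real_normed_vector \<Rightarrow> real"
  shows "(\<exists>l. has_right_derivative f x v l) \<longleftrightarrow>
    (\<forall>k::nat. \<exists>n::nat. \<forall>s\<in>{0<..<1 / Suc n}. \<forall>t\<in>{0<..<1 / Suc n}.
       \<bar>(f (x + s *\<^sub>R v) - f x) / s - (f (x + t *\<^sub>R v) - f x) / t\<bar> \<le> 1 / Suc k)"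
  (is "?L \<longleftrightarrow> ?R")
proof -
  define q where "q t = (f (x + t *\<^sub>R v) - f x) / t" for t
  have "(\<exists>l. (q \<longlongrightarrow> l) (at_right 0)) \<longleftrightarrow>
    (\<forall>k::nat. \<exists>n::nat. \<forall>s\<in>{0<..<1 / Suc n}. \<forall>t\<in>{0<..<1 / Suc n}. \<bar>q s - q t\<bar> \<le> 1 / Suc k)"
    (is "?L' \<longleftrightarrow> ?R'")
  proof
    assume ?L'
    then obtain l where l: "(q \<longlongrightarrow> l) (at_right 0)" by blast
    show ?R'
    proof
      fix k :: nat
      define e :: real where "e = 1 / Suc k"
      have "\<forall>\<^sub>F t in at_right 0. dist (q t) l < e / 2"
        by (rule tendstoD[OF l]) (simp add: e_def)
      then obtain d where d: "d > 0" "\<And>t. 0 < t \<Longrightarrow> t < d \<Longrightarrow> \<bar>q t - l\<bar> < e / 2"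
        unfolding eventually_at_right_field dist_real_def by blast
      obtain n where n: "1 / Suc n < d"
        using d(1) nat_approx_posE by blast
      have "\<bar>q s - q t\<bar> \<le> 1 / Suc k" if "s\<in>{0<..<1 / Suc n}" "t\<in>{0<..<1 / Suc n}" for s t
      proof -
        have "\<bar>q s - l\<bar> < e / 2" "\<bar>q t - l\<bar> < e / 2"
          using d(2) that n by auto
        then show ?thesis unfolding e_def[symmetric] by linarith
      qed
      then show "\<exists>n::nat. \<forall>s\<in>{0<..<1 / Suc n}. \<forall>t\<in>{0<..<1 / Suc n}. \<bar>q s - q t\<bar> \<le> 1 / Suc k"
        by blast
    qed
  next
    assume R: ?R'
    \<comment> \<open>The two \<open>Suc\<close> are needed because the intervals are open: the
      sample point must lie strictly below 1 / Suc n already for m = n.\<close>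
    define X where "X n = q (1 / Suc (Suc n))" for n
    have small: "1 / Suc (Suc m) \<in> {0<..<1 / real (Suc n)}" if "m \<ge> n" for m n
      using that by (auto simp: field_simps)
    have "Cauchy X"
    proof (rule metric_CauchyI)
      fix e :: real assume "e > 0"
      then obtain k where k: "1 / Suc k < e"
        using nat_approx_posE by blast
      obtain n where "\<forall>s\<in>{0<..<1 / Suc n}. \<forall>t\<in>{0<..<1 / Suc n}. \<bar>q s - q t\<bar> \<le> 1 / Suc k"
        using R by blast
      then have "\<forall>m\<ge>n. \<forall>m'\<ge>n. dist (X m) (X m') < e"
        using small k unfolding X_def dist_real_def by (meson le_less_trans)
      then show "\<exists>M. \<forall>m\<ge>M. \<forall>n\<ge>M. dist (X m) (X n) < e" by blast
    qed
    then obtain l where l: "X \<longlonglongrightarrow> l"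
      using Cauchy_convergent convergent_def by blast
    have "(q \<longlongrightarrow> l) (at_right 0)"
    proof (rule tendstoI)
      fix e :: real assume "e > 0"
      then obtain k where k: "1 / Suc k < e"
        using nat_approx_posE by blast
      obtain n where n: "\<forall>s\<in>{0<..<1 / Suc n}. \<forall>t\<in>{0<..<1 / Suc n}. \<bar>q s - q t\<bar> \<le> 1 / Suc k"
        using R by blast
      have "dist (q t) l < e" if t: "t \<in> {0<..<1 / Suc n}" for t
      proof -
        have "(\<lambda>m. \<bar>q t - X m\<bar>) \<longlonglongrightarrow> \<bar>q t - l\<bar>"
          by (intro tendsto_intros l)
        moreover have "\<forall>m\<ge>n. \<bar>q t - X m\<bar> \<le> 1 / Suc k"
          using n t small unfolding X_def by blast
        ultimately have "\<bar>q t - l\<bar> \<le> 1 / Suc k"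
          by (intro LIMSEQ_le_const2) blast+
        then show ?thesis using k by (simp add: dist_real_def)
      qed
      then show "\<forall>\<^sub>F t in at_right 0. dist (q t) l < e"
        unfolding eventually_at_right_field by (intro exI[of _ "1 / real (Suc n)"]) auto
    qed
    then show ?L' by blast
  qed
  then show ?thesis
    by (simp add: has_right_derivative_def q_def[abs_def])
qed

text \<open>The intersection over s and t is uncountable, but the non-strict inequality makes each
  set closed, so the intersection is closed as well. Only the quantifiers over k and n have to be
  countable.\<close>

lemma borel_right_derivative_exists:
  fixes f :: "'a::real_normed_vector \<Rightarrow> real"
  assumes "continuous_on UNIV f"
  shows "{x. \<exists>l. has_right_derivative f x v l} \<in> sets borel"
proof -
  have c: "continuous_on UNIV (\<lambda>x. f (x + t *\<^sub>R v))" for t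
    by (rule continuous_on_compose2[OF assms]) (auto intro!: continuous_intros)
  define C where "C n k = (\<Inter>s\<in>{0<..<1 / real (Suc n)}. \<Inter>t\<in>{0<..<1 / real (Suc n)}.
       {x. \<bar>(f (x + s *\<^sub>R v) - f x) / s - (f (x + t *\<^sub>R v) - f x) / t\<bar> \<le> 1 / real (Suc k)})" for n k :: nat
  have "closed (C n k)" for n k
    unfolding C_def by (intro closed_INT ballI closed_Collect_le continuous_intros c assms) auto
  moreover have "{x. \<exists>l. has_right_derivative f x v l} = (\<Inter>k. \<Union>n. C n k)"
    unfolding right_derivative_exists_iff C_def by auto
  ultimately show ?thesis
    by (auto intro!: sets.countable_INT' sets.countable_UN borel_closed)
qed

text \<open>On every line parallel to v the one-dimensional result applies with constant L |v|;
  Borel measurability of the good set then lets \<open>AE_lborel_lines\<close> assemble the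
  lines.\<close>

lemma Lipschitz_AE_right_derivative:
  fixes f :: "'a::euclidean_space \<Rightarrow> real"
  assumes lip: "L-lipschitz_on UNIV f"
  shows "AE x in lborel. \<exists>l. has_right_derivative f x v l"
proof -
  have "{x. \<exists>l. has_right_derivative f x v l} \<in> sets borel" (is "?S \<in> _")
    by (intro borel_right_derivative_exists lipschitz_on_continuous_on[OF lip])
  moreover have "AE t in lborel. x + t *\<^sub>R v \<in> ?S" for x
  proof -
    have "\<bar>f (x + s *\<^sub>R v) - f (x + t *\<^sub>R v)\<bar> \<le> (L * norm v) * \<bar>s - t\<bar>" for s t
      using lipschitz_onD[OF lip, of "x + s *\<^sub>R v" "x + t *\<^sub>R v"]
      by (simp add: dist_norm algebra_simps flip: scaleR_left_diff_distrib)
    then obtain D N where "negligible N" and N: "\<And>t. t \<notin> N \<Longrightarrow>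
        ((\<lambda>h. (f (x + (t + h) *\<^sub>R v) - f (x + t *\<^sub>R v)) / h) \<longlongrightarrow> D t) (at_right 0)"
      by (rule Lipschitz_right_derivative[of "\<lambda>t. f (x + t *\<^sub>R v)"]) blast
    have "x + t *\<^sub>R v \<in> ?S" if "t \<notin> N" for t
      using N[OF that] by (auto simp: has_right_derivative_def algebra_simps)
    then show ?thesis
      unfolding AE_lborel_iff_negligible
      by (intro negligible_subset[OF \<open>negligible N\<close>]) auto
  qed
  ultimately show ?thesis
    using AE_lborel_lines[of ?S v] by auto
qed

section \<open>Approach to density points\<close>

lemma content_cbox_One:
  fixes x :: "'a::euclidean_space"
  assumes "0 \<le> h"
  shows "measure lborel (cbox x (x + h *\<^sub>R One)) = h ^ DIM('a)"
  using assms by (subst content_cbox) (auto simp: inner_simps)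

text \<open>The available density theorem averages over cubes having x as their lowest corner, which is why
  only directions u in the nonnegative orthant are covered.\<close>

lemma negligible_not_near_forward:
  fixes A :: "'a::euclidean_space set"
  assumes "closed A"
  obtains N where "negligible N"
    "\<And>x u e. \<lbrakk>x \<in> A - N; \<And>b. b \<in> Basis \<Longrightarrow> 0 \<le> u \<bullet> b; 0 < e\<rbrakk> \<Longrightarrow>
       \<exists>d>0. \<forall>t. 0 < t \<and> t < d \<longrightarrow> (\<exists>y\<in>A. norm (x + t *\<^sub>R u - y) \<le> e * t)"
proof -
  have lm: "A \<inter> cbox a b \<in> lmeasurable" for a b
    using assms by (simp add: closed_Int_compact lmeasurable_compact)
  have int: "indicat_real A integrable_on cbox a b" for a b
    using lm[of a b] by (simp add: integrable_on_indicator Int_commute)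
  have integral: "integral (cbox a b) (indicat_real A) = measure lebesgue (A \<inter> cbox a b)" for a b
    using lm[of a b] by (simp add: integral_indicator)
  obtain N where N: "negligible N" and lim: "\<And>x e. \<lbrakk>x \<notin> N; 0 < e\<rbrakk> \<Longrightarrow>
     \<exists>d>0. \<forall>h. 0 < h \<and> h < d \<longrightarrow>
        norm (integral (cbox x (x + h *\<^sub>R One)) (indicat_real A) /\<^sub>R h ^ DIM('a) - indicator A x) < e"
    using integrable_ccontinuous_explicit[OF int] by metis
  have "\<exists>d>0. \<forall>t. 0 < t \<and> t < d \<longrightarrow> (\<exists>y\<in>A. norm (x + t *\<^sub>R u - y) \<le> e * t)"
    if x: "x \<in> A - N" and u: "\<And>b. b \<in> Basis \<Longrightarrow> 0 \<le> u \<bullet> b" and e: "0 < e" for x u e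
  proof -
    \<comment> \<open>The cube Q of side t c at x + t u lies within l1-distance t c DIM = e t of
      that point. Since 0 <= u . b <= |u|, it is contained in the cube of side t K at x, of which it
      occupies the fixed fraction (c / K)^DIM. If A missed Q, the density of A at x could not be
      1.\<close>
    define c where "c = e / DIM('a)"
    define K where "K = norm u + c"
    have c: "0 < c" "c \<le> K" "0 < K"
      using e by (auto simp: c_def K_def add_nonneg_pos)
    obtain d where d: "d > 0" "\<And>h. 0 < h \<Longrightarrow> h < d \<Longrightarrow>
        norm (integral (cbox x (x + h *\<^sub>R One)) (indicat_real A) /\<^sub>R h ^ DIM('a) - indicator A x) < (c / K) ^ DIM('a)"
      using lim[of x "(c / K) ^ DIM('a)"] x c by auto
    have "\<exists>y\<in>A. norm (x + t *\<^sub>R u - y) \<le> e * t" if t: "0 < t" "t < d / K" for t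
    proof (rule ccontr)
      assume far: "\<not> ?thesis"
      define h where "h = t * K"
      define Q where "Q = cbox (x + t *\<^sub>R u) ((x + t *\<^sub>R u) + (t * c) *\<^sub>R One)"
      have h: "0 < h" "h < d"
        using t c by (auto simp: h_def field_simps)
      have "Q \<subseteq> cbox x (x + h *\<^sub>R One)"
      proof
        fix y assume y: "y \<in> Q"
        show "y \<in> cbox x (x + h *\<^sub>R One)"
          unfolding mem_box
        proof
          fix b :: 'a assume b: "b \<in> Basis"
          have "x \<bullet> b + t * (u \<bullet> b) \<le> y \<bullet> b" "y \<bullet> b \<le> x \<bullet> b + t * (u \<bullet> b) + t * c"
            using y b by (auto simp: Q_def mem_box inner_simps)
          moreover have "0 \<le> t * (u \<bullet> b)" "t * (u \<bullet> b) \<le> t * norm u"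
            using u[OF b] Basis_le_norm[OF b, of u] t by auto
          ultimately show "x \<bullet> b \<le> y \<bullet> b \<and> y \<bullet> b \<le> (x + h *\<^sub>R One) \<bullet> b"
            using b by (auto simp: h_def K_def inner_simps algebra_simps)
        qed
      qed
      moreover have "A \<inter> Q = {}"
      proof (rule ccontr)
        assume "A \<inter> Q \<noteq> {}"
        then obtain y where y: "y \<in> A" "y \<in> Q" by blast
        have "norm (x + t *\<^sub>R u - y) \<le> (\<Sum>b\<in>Basis. \<bar>(x + t *\<^sub>R u - y) \<bullet> b\<bar>)"
          by (rule norm_le_l1)
        also have "\<dots> \<le> (\<Sum>b\<in>(Basis::'a set). t * c)"
        proof (rule sum_mono)
          fix b :: 'a assume b: "b \<in> Basis"
          have "x \<bullet> b + t * (u \<bullet> b) \<le> y \<bullet> b" "y \<bullet> b \<le> x \<bullet> b + t * (u \<bullet> b) + t * c"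
            using y b by (auto simp: Q_def mem_box inner_simps)
          then show "\<bar>(x + t *\<^sub>R u - y) \<bullet> b\<bar> \<le> t * c"
            by (auto simp: inner_simps)
        qed
        also have "\<dots> = e * t"
          by (simp add: c_def)
        finally show False using far y(1) by blast
      qed
      moreover have "emeasure lebesgue (A \<inter> cbox x (x + h *\<^sub>R One)) \<noteq> \<infinity>" "emeasure lebesgue Q \<noteq> \<infinity>"
        using fmeasurableD2[OF lm] fmeasurableD2[of Q lebesgue] by (auto simp: Q_def)
      ultimately have "measure lebesgue (A \<inter> cbox x (x + h *\<^sub>R One)) + measure lebesgue Q
          = measure lebesgue ((A \<inter> cbox x (x + h *\<^sub>R One)) \<union> Q)"
        using lm[of x "x + h *\<^sub>R One"]
        by (intro measure_Union[symmetric]) (simp_all add: Q_def fmeasurableD disjoint_iff)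
      also have "\<dots> \<le> measure lebesgue (cbox x (x + h *\<^sub>R One))"
        using lm[of x "x + h *\<^sub>R One"] \<open>Q \<subseteq> _\<close>
        by (intro measure_mono_fmeasurable) (auto simp: Q_def)
      finally have le: "measure lebesgue (A \<inter> cbox x (x + h *\<^sub>R One)) + (t * c) ^ DIM('a) \<le> h ^ DIM('a)"
        using t c h by (simp add: Q_def content_cbox_One)
      have "(t * c) ^ DIM('a) = h ^ DIM('a) * (c / K) ^ DIM('a)"
        using c by (simp add: h_def flip: power_mult_distrib)
      with le have "measure lebesgue (A \<inter> cbox x (x + h *\<^sub>R One)) / h ^ DIM('a) \<le> 1 - (c / K) ^ DIM('a)"
        using h by (simp add: field_simps)
      with d(2)[OF h] x show False
        by (simp add: integral divide_inverse_commute)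
    qed
    then show ?thesis
      using d(1) c by (intro exI[of _ "d / K"]) auto
  qed
  with N that show thesis by blast
qed

section \<open>Additivity of right derivatives and total differentiability\<close>

lemma rational_vectors:
  defines "V \<equiv> {v::'a::euclidean_space. \<forall>b\<in>Basis. v \<bullet> b \<in> \<rat>}"
  shows countable_rational_vectors: "countable V"
    and closure_rational_vectors: "closure V = UNIV"
proof -
  have "V \<subseteq> (\<lambda>f. \<Sum>b\<in>Basis. f b *\<^sub>R b) ` (Basis \<rightarrow>\<^sub>E \<rat>)"
  proof
    fix v assume "v \<in> V"
    then show "v \<in> (\<lambda>f. \<Sum>b\<in>Basis. f b *\<^sub>R b) ` (Basis \<rightarrow>\<^sub>E \<rat>)"
      by (intro image_eqI[of _ _ "\<lambda>b\<in>Basis. v \<bullet> b"]) (auto simp: V_def euclidean_representation)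
  qed
  then show "countable V"
    by (rule countable_subset) (intro countable_image countable_PiE countable_rat finite_Basis)
  have "(\<Union>f \<in> Basis \<rightarrow> \<rat>. { \<Sum>i :: 'a :: euclidean_space \<in> Basis. f i *\<^sub>R i }) \<subseteq> V"
    by (auto simp: V_def)
  from closure_mono[OF this] show "closure V = UNIV"
    by (simp add: closure_rational_coordinates subset_antisym)
qed

lemma has_right_derivative_0: "has_right_derivative f x 0 0"
  by (simp add: has_right_derivative_def)

lemma has_right_derivative_unique:
  "has_right_derivative f x v l \<Longrightarrow> has_right_derivative f x v m \<Longrightarrow> l = m"
  unfolding has_right_derivative_def by (rule tendsto_unique[rotated]) auto

lemma has_right_derivative_scale:
  assumes "has_right_derivative f x v l" "0 \<le> c"
  shows "has_right_derivative f x (c *\<^sub>R v) (c * l)"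
proof (cases "c = 0")
  case False
  with assms have "c > 0" by simp
  then have "filterlim (\<lambda>t. t * c) (at_right 0) (at_right 0)"
    unfolding filterlim_at
    by (auto intro!: tendsto_eq_intros eventually_at_right_less[THEN eventually_mono])
  then have "((\<lambda>t. (f (x + (t * c) *\<^sub>R v) - f x) / (t * c)) \<longlongrightarrow> l) (at_right 0)"
    using assms(1) unfolding has_right_derivative_def by (rule filterlim_compose[rotated])
  then have "((\<lambda>t. c * ((f (x + (t * c) *\<^sub>R v) - f x) / (t * c))) \<longlongrightarrow> c * l) (at_right 0)"
    by (intro tendsto_intros)
  then show ?thesis
    using \<open>c > 0\<close> by (simp add: has_right_derivative_def)
qed (simp add: has_right_derivative_0)

text \<open>Here z is a rational substitute for the right derivative along w, 1 / Suc k is the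
  accuracy and 1 / Suc m the range of step lengths. For fixed w these closed sets form a countable
  family, so their exceptional null sets can be united.\<close>

definition flat_set :: "('a::real_normed_vector \<Rightarrow> real) \<Rightarrow> 'a \<Rightarrow> real \<Rightarrow> nat \<Rightarrow> nat \<Rightarrow> 'a set" where
  "flat_set f w z k m =
     {y. \<forall>t\<in>{0<..<1 / Suc m}. \<bar>f (y + t *\<^sub>R w) - f y - t * z\<bar> \<le> t / Suc k}"

lemma closed_flat_set:
  assumes "continuous_on UNIV f"
  shows "closed (flat_set f w z k m)"
proof -
  have c: "continuous_on UNIV (\<lambda>x. f (x + t *\<^sub>R w))" for t
    by (rule continuous_on_compose2[OF assms]) (auto intro!: continuous_intros)
  have "flat_set f w z k m = (\<Inter>t\<in>{0<..<1 / real (Suc m)}.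
      {y. \<bar>f (y + t *\<^sub>R w) - f y - t * z\<bar> \<le> t / real (Suc k)})"
    unfolding flat_set_def by auto
  also have "closed \<dots>"
    by (intro closed_INT ballI closed_Collect_le continuous_intros c assms) 
  finally show ?thesis .
qed

lemma has_right_derivative_in_flat_set:
  assumes "has_right_derivative f x w b"
  obtains z m where "z \<in> \<rat>" "x \<in> flat_set f w z k m"
proof -
  define e :: real where "e = 1 / (2 * Suc k)"
  have e: "e > 0" "e + e = 1 / Suc k"
    by (auto simp: e_def field_simps)
  obtain z where z: "z \<in> \<rat>" "\<bar>z - b\<bar> < e"
    using rational_approximation[of e b] e by (auto simp: abs_minus_commute)
  obtain d where d: "d > 0" "\<And>t. 0 < t \<Longrightarrow> t < d \<Longrightarrow> \<bar>f (x + t *\<^sub>R w) - f x - t * b\<bar> \<le> e * t"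
    using has_right_derivativeD[OF assms e(1)] by blast
  obtain m where m: "1 / Suc m < d"
    using d(1) nat_approx_posE by blast
  have "\<bar>f (x + t *\<^sub>R w) - f x - t * z\<bar> \<le> t / Suc k" if "t \<in> {0<..<1 / Suc m}" for t
  proof -
    have "\<bar>t * (z - b)\<bar> \<le> t * e"
      using z(2) that by (simp add: abs_mult)
    moreover have "\<bar>f (x + t *\<^sub>R w) - f x - t * b\<bar> \<le> e * t"
      using d(2)[of t] that m by auto
    ultimately have "\<bar>f (x + t *\<^sub>R w) - f x - t * z\<bar> \<le> t * (e + e)"
      by (simp add: algebra_simps abs_le_iff)
    then show ?thesis by (simp only: e) simp
  qed
  then have "x \<in> flat_set f w z k m"
    unfolding flat_set_def by blast
  with that z(1) show thesis by blast
qed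

text \<open>Points of \<^term>\<open>flat_set f w z k m\<close> accumulate at almost all its points x from every
  direction u of the nonnegative orthant, so the increment of f along w at x + t u is
  comparable with that at x.\<close>

lemma has_right_derivative_add_approx:
  fixes f :: "'a::euclidean_space \<Rightarrow> real"
  assumes lip: "L-lipschitz_on UNIV f"
    and a: "has_right_derivative f x u a" and b: "has_right_derivative f x w b"
    and c: "has_right_derivative f x (u + w) c"
    and x: "x \<in> flat_set f w z k m"
    and near: "\<And>e. 0 < e \<Longrightarrow>
       \<exists>d>0. \<forall>t. 0 < t \<and> t < d \<longrightarrow> (\<exists>y\<in>flat_set f w z k m. norm (x + t *\<^sub>R u - y) \<le> e * t)"
  shows "\<bar>c - a - b\<bar> \<le> 3 / Suc k"
proof -
  define \<epsilon> :: real where "\<epsilon> = 1 / Suc k"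
  \<comment> \<open>With this value the two Lipschitz errors from replacing x + t u by y add up to
    at most t \<open>\<epsilon>\<close> / 6. Three difference quotients cost t
    \<open>\<epsilon>\<close> / 6 each and the two uses of flatness cost t \<open>\<epsilon>\<close>
    each; the sum is below 3 t \<open>\<epsilon>\<close>.\<close>
  define \<eta> where "\<eta> = \<epsilon> / (12 * (L + 1))"
  have L: "L \<ge> 0"
    using lip by (rule lipschitz_on_nonneg)
  have pos: "\<epsilon> > 0" "\<eta> > 0" "\<epsilon> / 6 > 0"
    using L by (auto simp: \<epsilon>_def \<eta>_def)
  have L\<eta>: "2 * L * \<eta> \<le> \<epsilon> / 6"
    using L pos by (simp add: \<eta>_def field_simps)
  obtain d1 where d1: "d1 > 0" "\<And>t. 0 < t \<Longrightarrow> t < d1 \<Longrightarrow> \<bar>f (x + t *\<^sub>R u) - f x - t * a\<bar> \<le> \<epsilon> / 6 * t"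
    using has_right_derivativeD[OF a pos(3)] by blast
  obtain d2 where d2: "d2 > 0" "\<And>t. 0 < t \<Longrightarrow> t < d2 \<Longrightarrow> \<bar>f (x + t *\<^sub>R w) - f x - t * b\<bar> \<le> \<epsilon> / 6 * t"
    using has_right_derivativeD[OF b pos(3)] by blast
  obtain d3 where d3: "d3 > 0" "\<And>t. 0 < t \<Longrightarrow> t < d3 \<Longrightarrow> \<bar>f (x + t *\<^sub>R (u + w)) - f x - t * c\<bar> \<le> \<epsilon> / 6 * t"
    using has_right_derivativeD[OF c pos(3)] by blast
  obtain d4 where d4: "d4 > 0"
    "\<And>t. 0 < t \<Longrightarrow> t < d4 \<Longrightarrow> \<exists>y\<in>flat_set f w z k m. norm (x + t *\<^sub>R u - y) \<le> \<eta> * t"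
    using near[OF pos(2)] by blast
  define d where "d = Min {d1, d2, d3, d4, 1 / Suc m}"
  define t where "t = d / 2"
  have "d \<le> d1" "d \<le> d2" "d \<le> d3" "d \<le> d4" "d \<le> 1 / Suc m" "0 < d"
    using d1(1) d2(1) d3(1) d4(1) unfolding d_def by (auto simp: min_le_iff_disj)
  then have t: "0 < t" "t < d1" "t < d2" "t < d3" "t < d4" "t \<in> {0<..<1 / Suc m}"
    unfolding t_def by auto
  obtain y where y: "y \<in> flat_set f w z k m" "norm (x + t *\<^sub>R u - y) \<le> \<eta> * t"
    using d4(2) t by blast
  have "\<bar>f (x + t *\<^sub>R w) - f x - t * z\<bar> \<le> t * \<epsilon>" "\<bar>f (y + t *\<^sub>R w) - f y - t * z\<bar> \<le> t * \<epsilon>"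
    using x y(1) t(6) by (auto simp: flat_set_def \<epsilon>_def)
  moreover have "\<bar>f (x + t *\<^sub>R u) - f y\<bar> \<le> t * (L * \<eta>)"
  proof -
    have "\<bar>f (x + t *\<^sub>R u) - f y\<bar> \<le> L * norm (x + t *\<^sub>R u - y)"
      using lipschitz_onD[OF lip, of "x + t *\<^sub>R u" y] by (simp add: dist_norm)
    also have "\<dots> \<le> L * (\<eta> * t)"
      using y(2) L by (intro mult_left_mono)
    finally show ?thesis by (simp add: mult_ac)
  qed
  moreover have "\<bar>f (x + t *\<^sub>R (u + w)) - f (y + t *\<^sub>R w)\<bar> \<le> t * (L * \<eta>)"
  proof -
    have "\<bar>f (x + t *\<^sub>R (u + w)) - f (y + t *\<^sub>R w)\<bar> \<le> L * norm (x + t *\<^sub>R u - y)"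
      using lipschitz_onD[OF lip, of "x + t *\<^sub>R (u + w)" "y + t *\<^sub>R w"]
      by (simp add: dist_norm algebra_simps)
    also have "\<dots> \<le> L * (\<eta> * t)"
      using y(2) L by (intro mult_left_mono)
    finally show ?thesis by (simp add: mult_ac)
  qed
  moreover have "\<bar>f (x + t *\<^sub>R u) - f x - t * a\<bar> \<le> (t * \<epsilon>) / 6"
    "\<bar>f (x + t *\<^sub>R w) - f x - t * b\<bar> \<le> (t * \<epsilon>) / 6"
    "\<bar>f (x + t *\<^sub>R (u + w)) - f x - t * c\<bar> \<le> (t * \<epsilon>) / 6"
    using d1(2)[OF t(1,2)] d2(2)[OF t(1,3)] d3(2)[OF t(1,4)] by (simp_all add: mult.commute)
  moreover have "t * (L * \<eta>) \<le> (t * \<epsilon>) / 12"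
    using mult_left_mono[OF L\<eta>, of t] t(1) by simp
  ultimately have "\<bar>t * c - t * a - t * b\<bar> \<le> 3 * (t * \<epsilon>)"
    by linarith
  then have "\<bar>t * (c - a - b)\<bar> \<le> t * (3 * \<epsilon>)"
    by (simp add: algebra_simps)
  then have "\<bar>c - a - b\<bar> \<le> 3 * \<epsilon>"
    using t(1) by (simp add: abs_mult)
  then show ?thesis by (simp add: \<epsilon>_def)
qed

text \<open>The null set depends only on w and on the countably many triples (z, k, m), so it serves
  all directions u of the orthant at once. Exact additivity results from letting k tend to infinity
  in the bound 3 / Suc k.\<close>

lemma Lipschitz_AE_right_derivative_add:
  fixes f :: "'a::euclidean_space \<Rightarrow> real"
  assumes lip: "L-lipschitz_on UNIV f"
  shows "AE x in lborel. \<forall>u a b c. (\<forall>i\<in>Basis. 0 \<le> u \<bullet> i) \<longrightarrow> has_right_derivative f x u a \<longrightarrow>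
    has_right_derivative f x w b \<longrightarrow> has_right_derivative f x (u + w) c \<longrightarrow> c = a + b"
proof -
  let ?near = "\<lambda>A x u. \<forall>e>0. \<exists>d>0. \<forall>t. 0 < t \<and> t < d \<longrightarrow> (\<exists>y\<in>A. norm (x + t *\<^sub>R u - y) \<le> e * t)"
  have "AE x in lborel. x \<in> A \<longrightarrow> (\<forall>u. (\<forall>i\<in>Basis. 0 \<le> u \<bullet> i) \<longrightarrow> ?near A x u)"
    if A: "closed A" for A :: "'a set"
  proof -
    obtain N where "negligible N" and N: "\<And>x u e. \<lbrakk>x \<in> A - N; \<And>b. b \<in> Basis \<Longrightarrow> 0 \<le> u \<bullet> b; 0 < e\<rbrakk> \<Longrightarrow>
       \<exists>d>0. \<forall>t. 0 < t \<and> t < d \<longrightarrow> (\<exists>y\<in>A. norm (x + t *\<^sub>R u - y) \<le> e * t)"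
      using negligible_not_near_forward[OF A] by metis
    show ?thesis
      unfolding AE_lborel_iff_negligible
      by (rule negligible_subset[OF \<open>negligible N\<close>]) (use N in blast)
  qed
  moreover have "closed (flat_set f w z k m)" for z k m
    by (intro closed_flat_set lipschitz_on_continuous_on[OF lip])
  ultimately have "AE x in lborel. \<forall>z\<in>\<rat>. \<forall>k m. x \<in> flat_set f w z k m \<longrightarrow>
      (\<forall>u. (\<forall>i\<in>Basis. 0 \<le> u \<bullet> i) \<longrightarrow> ?near (flat_set f w z k m) x u)"
    by (simp add: AE_ball_countable AE_all_countable countable_rat)
  then show ?thesis
  proof (rule AE_mp, intro AE_I2 impI allI)
    fix x u a b c
    assume near: "\<forall>z\<in>\<rat>. \<forall>k m. x \<in> flat_set f w z k m \<longrightarrow>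
      (\<forall>u. (\<forall>i\<in>Basis. 0 \<le> u \<bullet> i) \<longrightarrow> ?near (flat_set f w z k m) x u)"
      and u: "\<forall>i\<in>Basis. 0 \<le> u \<bullet> i"
      and D: "has_right_derivative f x u a" "has_right_derivative f x w b"
        "has_right_derivative f x (u + w) c"
    have *: "\<bar>c - a - b\<bar> \<le> 3 / Suc k" for k :: nat
    proof -
      obtain z m where zm: "z \<in> \<rat>" "x \<in> flat_set f w z k m"
        using has_right_derivative_in_flat_set[OF D(2)] by blast
      with near u have "?near (flat_set f w z k m) x u" by blast
      then show ?thesis
        by (intro has_right_derivative_add_approx[OF lip D zm(2)]) blast
    qed
    have "\<bar>c - a - b\<bar> \<le> 0"
    proof (rule LIMSEQ_le_const)
      show "(\<lambda>k. 3 / real (Suc k)) \<longlonglongrightarrow> 0"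
        by (rule LIMSEQ_Suc[OF lim_const_over_n])
    qed (use * in blast)
    then show "c = a + b" by simp
  qed
qed

text \<open>Compactness of the unit sphere makes the directional limits uniform: finitely many
  rational directions come within r of every unit vector, and the Lipschitz bounds on f and T
  control the change from a unit vector to its approximation.\<close>

lemma has_derivative_rational_directions:
  fixes f :: "'a::euclidean_space \<Rightarrow> real"
  defines "V \<equiv> {v::'a. \<forall>b\<in>Basis. v \<bullet> b \<in> \<rat>}"
  assumes lip: "L-lipschitz_on UNIV f"
    and T: "bounded_linear T" and D: "\<And>v. v \<in> V \<Longrightarrow> has_right_derivative f x v (T v)"
  shows "(f has_derivative T) (at x)"
proof (rule has_derivativeI_sandwich[where e=1 and H="\<lambda>y. norm (f y - f x - T (y - x)) / norm (y - x)"])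
  obtain K where K: "K > 0" "\<And>v. norm (T v) \<le> norm v * K"
    using bounded_linear.pos_bounded[OF T] by blast
  have L: "L \<ge> 0"
    using lip by (rule lipschitz_on_nonneg)
  interpret T: bounded_linear T by fact
  show "((\<lambda>y. norm (f y - f x - T (y - x)) / norm (y - x)) \<longlongrightarrow> 0) (at x)"
  proof (rule tendstoI)
    fix e :: real assume "e > 0"
    \<comment> \<open>The three errors, t L r for f, t K r for T and t r for the difference
      quotient, sum to at most t e / 2.\<close>
    define r where "r = e / (2 * (L + K + 1))"
    have r: "r > 0" "(L + K + 1) * r < e"
      using L K(1) \<open>e > 0\<close> by (auto simp: r_def field_simps intro!: add_pos_nonneg)
    have "sphere 0 1 \<subseteq> (\<Union>v\<in>V. ball v r)"
    proof
      fix s :: 'a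
      have "s \<in> closure V"
        unfolding V_def by (simp add: closure_rational_vectors)
      then show "s \<in> (\<Union>v\<in>V. ball v r)"
        using r(1) by (auto simp: closure_approachable)
    qed
    then obtain W where W: "W \<subseteq> V" "finite W" "sphere 0 1 \<subseteq> (\<Union>v\<in>W. ball v r)"
      by (rule compactE_image[OF compact_sphere open_ball]) blast
    have "\<forall>v\<in>W. \<exists>d>0. \<forall>t. 0 < t \<and> t < d \<longrightarrow> \<bar>f (x + t *\<^sub>R v) - f x - t * T v\<bar> \<le> r * t"
    proof
      fix v assume "v \<in> W"
      then have "has_right_derivative f x v (T v)"
        using D W(1) by blast
      from has_right_derivativeD[OF this r(1)]
      show "\<exists>d>0. \<forall>t. 0 < t \<and> t < d \<longrightarrow> \<bar>f (x + t *\<^sub>R v) - f x - t * T v\<bar> \<le> r * t"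
        by metis
    qed
    then obtain d where d: "\<And>v. v \<in> W \<Longrightarrow> d v > 0"
      "\<And>v t. v \<in> W \<Longrightarrow> 0 < t \<Longrightarrow> t < d v \<Longrightarrow> \<bar>f (x + t *\<^sub>R v) - f x - t * T v\<bar> \<le> r * t"
      by metis
    define \<delta> where "\<delta> = Min (insert 1 (d ` W))"
    have \<delta>: "\<delta> > 0" "\<And>v. v \<in> W \<Longrightarrow> \<delta> \<le> d v"
      using W(2) d(1) by (auto simp: \<delta>_def)
    have "norm (f y - f x - T (y - x)) / norm (y - x) < e" if y: "y \<noteq> x" "dist y x < \<delta>" for y
    proof -
      define t where "t = norm (y - x)"
      define s where "s = (y - x) /\<^sub>R t"
      have t: "0 < t" "t < \<delta>"
        using y by (auto simp: t_def dist_norm)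
      have "norm s = 1" and ys: "y = x + t *\<^sub>R s"
        using t by (auto simp: s_def) (simp add: t_def)
      then obtain v where v: "v \<in> W" "norm (s - v) < r"
        using W(3) by (force simp: dist_norm norm_minus_commute)
      have "\<bar>f y - f (x + t *\<^sub>R v)\<bar> \<le> L * (t * norm (s - v))"
        using lipschitz_onD[OF lip, of y "x + t *\<^sub>R v"] t
        by (simp add: dist_norm ys flip: scaleR_right_diff_distrib)
      also have "\<dots> \<le> L * (t * r)"
        using v(2) t L by (intro mult_left_mono) auto
      finally have 1: "\<bar>f y - f (x + t *\<^sub>R v)\<bar> \<le> t * (L * r)" by (simp add: mult_ac)
      have "\<bar>T (v - s)\<bar> \<le> norm (v - s) * K"
        using K(2)[of "v - s"] by simp
      also have "\<dots> \<le> r * K"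
        using v(2) K(1) by (intro mult_right_mono) (auto simp: norm_minus_commute)
      finally have "\<bar>T v - T s\<bar> \<le> r * K" by (simp add: T.diff)
      then have "t * \<bar>T v - T s\<bar> \<le> t * (r * K)"
        using t by (intro mult_left_mono) auto
      then have 2: "\<bar>t * T v - t * T s\<bar> \<le> t * (r * K)"
        using t by (simp add: abs_mult flip: right_diff_distrib)
      have 3: "\<bar>f (x + t *\<^sub>R v) - f x - t * T v\<bar> \<le> r * t"
        using d(2)[OF v(1) t(1)] \<delta>(2)[OF v(1)] t(2) by simp
      have "\<bar>f y - f x - t * T s\<bar> \<le> t * ((L + K + 1) * r)"
        using 1 2 3 by (simp add: algebra_simps)
      then have "norm (f y - f x - T (y - x)) \<le> t * ((L + K + 1) * r)"
        by (simp add: ys T.scaleR)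
      also have "\<dots> < t * e"
        using r(2) t(1) by simp
      finally show ?thesis
        using t(1) by (simp add: t_def[symmetric] field_simps)
    qed
    then show "\<forall>\<^sub>F y in at x. dist (norm (f y - f x - T (y - x)) / norm (y - x)) 0 < e"
      using \<delta>(1) unfolding eventually_at by (intro exI[of _ \<delta>]) auto
  qed
qed (use T in auto)

theorem Rademacher_real:
  fixes f :: "'a::euclidean_space \<Rightarrow> real"
  assumes lip: "L-lipschitz_on UNIV f"
  shows "AE x in lborel. f differentiable at x"
proof -
  define V where "V = {v::'a. \<forall>b\<in>Basis. v \<bullet> b \<in> \<rat>}"
  have cV: "countable V"
    unfolding V_def by (rule countable_rational_vectors)
  have "AE x in lborel. \<forall>v\<in>V. \<exists>l. has_right_derivative f x v l"
    by (simp add: AE_ball_countable cV Lipschitz_AE_right_derivative[OF lip])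
  moreover have "AE x in lborel. \<forall>w\<in>V. \<forall>u a b c. (\<forall>i\<in>Basis. 0 \<le> u \<bullet> i) \<longrightarrow> has_right_derivative f x u a \<longrightarrow>
    has_right_derivative f x w b \<longrightarrow> has_right_derivative f x (u + w) c \<longrightarrow> c = a + b"
    by (simp only: AE_ball_countable cV Lipschitz_AE_right_derivative_add[OF lip] ball_triv simp_thms)
  ultimately show ?thesis
  proof eventually_elim
    fix x
    assume "\<forall>v\<in>V. \<exists>l. has_right_derivative f x v l"
    then obtain d where d: "\<And>v. v \<in> V \<Longrightarrow> has_right_derivative f x v (d v)"
      by metis
    assume "\<forall>w\<in>V. \<forall>u a b c. (\<forall>i\<in>Basis. 0 \<le> u \<bullet> i) \<longrightarrow> has_right_derivative f x u a \<longrightarrow>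
      has_right_derivative f x w b \<longrightarrow> has_right_derivative f x (u + w) c \<longrightarrow> c = a + b"
    then have add: "d (u + w) = d u + d w"
      if "u \<in> V" "w \<in> V" "u + w \<in> V" "\<forall>i\<in>Basis. 0 \<le> u \<bullet> i" for u w
      using that d by blast
    have BV: "c *\<^sub>R b \<in> V" if "b \<in> Basis" "c \<in> \<rat>" for b c
      using that by (auto simp: V_def inner_Basis)
    have VV: "u + w \<in> V" if "u \<in> V" "w \<in> V" for u w
      using that by (auto simp: V_def inner_simps)
    have scale: "d (c *\<^sub>R b) = c * d b" if "b \<in> Basis" "c \<in> \<rat>" "0 \<le> c" for b c
      using has_right_derivative_unique has_right_derivative_scale d BV that
      by (metis Rats_1 scaleR_one)
    \<comment> \<open>\<open>add\<close> requires its first summand in the nonnegative orthant. For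
      c < 0 it is applied to (-c) b + (c b + w) = w instead, whose first summand qualifies. Rational
      vectors are then built up one coordinate at a time.\<close>
    have step: "d (c *\<^sub>R b + w) = c * d b + d w" if b: "b \<in> Basis" and c: "c \<in> \<rat>" and w: "w \<in> V" for b c w
    proof (cases "0 \<le> c")
      case True
      then have "\<forall>i\<in>Basis. 0 \<le> (c *\<^sub>R b) \<bullet> i"
        using b by (auto simp: inner_Basis)
      then show ?thesis
        using add[of "c *\<^sub>R b" w] b c w BV VV scale True by simp
    next
      case False
      then have "\<forall>i\<in>Basis. 0 \<le> ((- c) *\<^sub>R b) \<bullet> i"
        using b by (auto simp: inner_Basis)
      moreover have "(- c) *\<^sub>R b \<in> V" "c *\<^sub>R b + w \<in> V"
        using b c w by (intro BV VV Rats_minus_iff[THEN iffD2]; simp)+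
      moreover have "(- c) *\<^sub>R b + (c *\<^sub>R b + w) = w" by simp
      ultimately have "d w = d ((- c) *\<^sub>R b) + d (c *\<^sub>R b + w)"
        using add w by metis
      moreover have "d ((- c) *\<^sub>R b) = (- c) * d b"
        using b c False by (intro scale) auto
      ultimately show ?thesis by simp
    qed
    define T where "T v = (\<Sum>b\<in>Basis. (v \<bullet> b) * d b)" for v
    have T: "bounded_linear T"
      unfolding T_def[abs_def]
      by (intro bounded_linear_sum bounded_linear_mult_left bounded_linear_inner_left
          bounded_linear_compose[OF bounded_linear_mult_left, unfolded o_def])
    have "d v = T v" if v: "v \<in> V" for v
    proof -
      have "(\<Sum>b\<in>S. (v \<bullet> b) *\<^sub>R b) \<in> V \<and> d (\<Sum>b\<in>S. (v \<bullet> b) *\<^sub>R b) = (\<Sum>b\<in>S. (v \<bullet> b) * d b)"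
        if "finite S" "S \<subseteq> Basis" for S
        using that
      proof (induction S)
        case empty
        have "0 \<in> V" by (simp add: V_def)
        then have "d 0 = 0"
          using d has_right_derivative_0 has_right_derivative_unique by blast
        then show ?case using \<open>0 \<in> V\<close> by simp
      next
        case (insert b S)
        then have "v \<bullet> b \<in> \<rat>"
          using v by (auto simp: V_def)
        then show ?case
          using insert step BV VV by simp
      qed
      from this[of Basis] show ?thesis
        by (simp add: euclidean_representation T_def)
    qed
    with d have "has_right_derivative f x v (T v)" if "v \<in> V" for v
      using that by metis
    then have "(f has_derivative T) (at x)"
      unfolding V_def by (intro has_derivative_rational_directions[OF lip T]) auto
    then show "f differentiable at x"
      by (rule differentiableI)
  qed
qed

theorem Rademacher:
  fixes f :: "'a::euclidean_space \<Rightarrow> 'b::euclidean_space"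
  assumes lip: "L-lipschitz_on UNIV f"
  shows "AE x in lborel. f differentiable at x"
proof -
  have "L-lipschitz_on UNIV (\<lambda>x. f x \<bullet> b)" if "b \<in> Basis" for b
  proof (rule lipschitz_onI)
    fix x y
    have "\<bar>(f x - f y) \<bullet> b\<bar> \<le> norm (f x - f y)"
      using that by (rule Basis_le_norm)
    also have "\<dots> \<le> L * dist x y"
      using lipschitz_onD[OF lip, of x y] by (simp add: dist_norm)
    finally show "dist (f x \<bullet> b) (f y \<bullet> b) \<le> L * dist x y"
      by (simp add: dist_real_def inner_diff_left)
  qed (rule lipschitz_on_nonneg[OF lip])
  then have "AE x in lborel. \<forall>b\<in>Basis. (\<lambda>x. f x \<bullet> b) differentiable at x"
    by (subst AE_ball_countable) (auto intro: countable_finite Rademacher_real)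
  then show ?thesis
    by eventually_elim (simp add: differentiable_componentwise_within[of f])
qed

section \<open>Semicontinuous and strongly convex functions\<close>

lemma eff_dom_ereal:
  assumes "\<phi> x \<noteq> -\<infinity>" "x \<in> eff_dom \<phi>"
  shows "\<phi> x = ereal (real_of_ereal (\<phi> x))"
  using assms by (cases "\<phi> x") (auto simp: eff_dom_def)

lemma not_eff_dom: "x \<notin> eff_dom \<phi> \<Longrightarrow> \<phi> x = \<infinity>"
  by (auto simp: eff_dom_def)

text \<open>Both coefficients are positive because l lies in the open interval, so a point outside
  the domain makes the right-hand side infinite and the inequality trivial. What remains is
  arithmetic in the reals.\<close>

lemma s_convex_iff_real:
  assumes nm: "\<And>x. \<phi> x \<noteq> -\<infinity>"
  shows "s_convex s \<phi> \<longleftrightarrow>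
    (\<forall>x\<in>eff_dom \<phi>. \<forall>y\<in>eff_dom \<phi>. \<forall>l\<in>{0<..<1}. (1 - l) *\<^sub>R x + l *\<^sub>R y \<in> eff_dom \<phi> \<and>
      real_of_ereal (\<phi> ((1 - l) *\<^sub>R x + l *\<^sub>R y)) \<le> (1 - l) * real_of_ereal (\<phi> x)
        + l * real_of_ereal (\<phi> y) - s / 2 * l * (1 - l) * (norm (x - y))\<^sup>2)" (is "_ \<longleftrightarrow> ?R")
proof -
  have *: "\<phi> ((1 - l) *\<^sub>R x + l *\<^sub>R y) \<le> ereal (1 - l) * \<phi> x + ereal l * \<phi> y
             - ereal (s / 2 * l * (1 - l) * (norm (x - y))\<^sup>2) \<longleftrightarrow>
     (x \<in> eff_dom \<phi> \<longrightarrow> y \<in> eff_dom \<phi> \<longrightarrow> (1 - l) *\<^sub>R x + l *\<^sub>R y \<in> eff_dom \<phi> \<and>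
      real_of_ereal (\<phi> ((1 - l) *\<^sub>R x + l *\<^sub>R y)) \<le> (1 - l) * real_of_ereal (\<phi> x)
        + l * real_of_ereal (\<phi> y) - s / 2 * l * (1 - l) * (norm (x - y))\<^sup>2)"
    if "l \<in> {0<..<1}" for x y l
    using nm[of x] nm[of y] nm[of "(1 - l) *\<^sub>R x + l *\<^sub>R y"] that
    by (cases "\<phi> x"; cases "\<phi> y"; cases "\<phi> ((1 - l) *\<^sub>R x + l *\<^sub>R y)") (auto simp: eff_dom_def)
  show ?thesis
    unfolding s_convex_def using * by meson
qed

lemma lower_semicontinuous_iff_open:
  "lower_semicontinuous \<phi> \<longleftrightarrow> (\<forall>c. open {x. c < \<phi> x})"
proof
  assume lsc: "lower_semicontinuous \<phi>"
  show "\<forall>c. open {x. c < \<phi> x}"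
  proof
    fix c
    show "open {x. c < \<phi> x}"
    proof (subst open_subopen, safe)
      fix x assume c: "c < \<phi> x"
      then have "c < Liminf (at x) \<phi>"
        using lsc less_le_trans by (auto simp: lower_semicontinuous_def)
      then have "\<forall>\<^sub>F y in at x. c < \<phi> y"
        by (rule less_LiminfD)
      with c have "\<forall>\<^sub>F y in nhds x. c < \<phi> y"
        by (simp add: eventually_nhds_conv_at)
      then show "\<exists>T. open T \<and> x \<in> T \<and> T \<subseteq> {x. c < \<phi> x}"
        by (auto simp: eventually_nhds)
    qed
  qed
next
  assume op: "\<forall>c. open {x. c < \<phi> x}"
  show "lower_semicontinuous \<phi>"
    unfolding lower_semicontinuous_def le_Liminf_iff
  proof (intro allI impI)
    fix x c assume "c < \<phi> x"
    then have "\<forall>\<^sub>F y in nhds x. c < \<phi> y"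
      using op by (auto simp: eventually_nhds intro!: exI[of _ "{x. c < \<phi> x}"])
    then show "\<forall>\<^sub>F y in at x. c < \<phi> y"
      by (simp add: eventually_nhds_conv_at)
  qed
qed

lemma lower_semicontinuous_add_continuous:
  assumes lsc: "lower_semicontinuous \<phi>" and q: "continuous_on UNIV q"
  shows "lower_semicontinuous (\<lambda>x. \<phi> x + ereal (q x))"
  unfolding lower_semicontinuous_iff_open
proof
  fix c
  have "{x. c < \<phi> x + ereal (q x)} = (\<Union>d. {x. ereal d < \<phi> x} \<inter> {x. c < ereal (d + q x)})"
  proof (intro equalityI subsetI)
    fix x assume "x \<in> {x. c < \<phi> x + ereal (q x)}"
    then have "c - ereal (q x) < \<phi> x"
      by (cases c; cases "\<phi> x") auto
    then obtain d where "c - ereal (q x) < ereal d" "ereal d < \<phi> x"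
      using ereal_dense2 by blast
    moreover from this(1) have "c < ereal (d + q x)"
      by (cases c) auto
    ultimately show "x \<in> (\<Union>d. {x. ereal d < \<phi> x} \<inter> {x. c < ereal (d + q x)})"
      by blast
  next
    fix x assume "x \<in> (\<Union>d. {x. ereal d < \<phi> x} \<inter> {x. c < ereal (d + q x)})"
    then show "x \<in> {x. c < \<phi> x + ereal (q x)}"
      by (cases c; cases "\<phi> x") auto
  qed
  moreover have "open {x. c < ereal (d + q x)}" for d
    by (intro open_Collect_less continuous_intros q)
  ultimately show "open {x. c < \<phi> x + ereal (q x)}"
    using lsc by (auto simp: lower_semicontinuous_iff_open intro!: open_UN open_Int)
qed

text \<open>Without a minimizer the open sets {x. \<open>\<phi>\<close> y < \<open>\<phi>\<close> x}
  with y in K would cover K. In a finite subcover, the y of least value would lie in none of the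
  chosen sets.\<close>

lemma lower_semicontinuous_attains_inf:
  assumes lsc: "lower_semicontinuous \<phi>" and K: "compact K" "K \<noteq> {}"
  obtains p where "p \<in> K" "\<And>y. y \<in> K \<Longrightarrow> \<phi> p \<le> \<phi> y"
proof (rule ccontr)
  assume "\<not> thesis"
  with that have "\<forall>p\<in>K. \<exists>y\<in>K. \<phi> y < \<phi> p"
    by (meson not_le)
  then have cover: "K \<subseteq> (\<Union>y\<in>K. {x. \<phi> y < \<phi> x})"
    by blast
  have op: "open {x. \<phi> y < \<phi> x}" for y
    using lsc by (simp add: lower_semicontinuous_iff_open)
  obtain W where W: "W \<subseteq> K" "finite W" "K \<subseteq> (\<Union>y\<in>W. {x. \<phi> y < \<phi> x})"
    by (rule compactE_image[OF K(1) op cover])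
  then have "W \<noteq> {}" using K(2) by auto
  with W(2) have "Min (\<phi> ` W) \<in> \<phi> ` W"
    by (intro Min_in) auto
  then obtain y where y: "y \<in> W" "\<phi> y = Min (\<phi> ` W)"
    by auto
  then obtain w where w: "w \<in> W" "\<phi> w < \<phi> y"
    using W(1,3) by blast
  have "\<phi> y \<le> \<phi> w"
    unfolding y(2) using W(2) w(1) by (intro Min_le) auto
  with w(2) show False
    by simp
qed

text \<open>By the identity \<open>sq\<close>, half the squared distance to z satisfies the
  convexity inequality of modulus 1 with equality, so the moduli simply add.\<close>

lemma s_convex_add_square:
  assumes nm: "\<And>x. \<phi> x \<noteq> -\<infinity>" and "s_convex s \<phi>"
  shows "s_convex (s + r) (\<lambda>x. \<phi> x + ereal (r / 2 * (norm (x - z))\<^sup>2))"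
proof -
  let ?G = "\<lambda>x. \<phi> x + ereal (r / 2 * (norm (x - z))\<^sup>2)"
  have dom: "eff_dom ?G = eff_dom \<phi>"
    by (auto simp: eff_dom_def)
  have val: "real_of_ereal (?G x) = real_of_ereal (\<phi> x) + r / 2 * (norm (x - z))\<^sup>2"
    if "x \<in> eff_dom \<phi>" for x
    using eff_dom_ereal[where \<phi>=\<phi>, OF nm that] by (metis plus_ereal.simps(1) real_of_ereal.simps(1))
  have nm': "?G x \<noteq> -\<infinity>" for x
    using nm[of x] by (cases "\<phi> x") auto
  have sq: "(norm ((1 - l) *\<^sub>R x + l *\<^sub>R y - z))\<^sup>2 =
      (1 - l) * (norm (x - z))\<^sup>2 + l * (norm (y - z))\<^sup>2 - l * (1 - l) * (norm (x - y))\<^sup>2" for x y l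
    unfolding power2_norm_eq_inner by (simp add: inner_simps inner_commute algebra_simps)
  show ?thesis
    unfolding s_convex_iff_real[where \<phi>="?G", OF nm'] dom
  proof (intro ballI)
    fix x y and l :: real assume xy: "x \<in> eff_dom \<phi>" "y \<in> eff_dom \<phi>" "l \<in> {0<..<1}"
    let ?w = "(1 - l) *\<^sub>R x + l *\<^sub>R y"
    have w: "?w \<in> eff_dom \<phi>" "real_of_ereal (\<phi> ?w) \<le> (1 - l) * real_of_ereal (\<phi> x)
        + l * real_of_ereal (\<phi> y) - s / 2 * l * (1 - l) * (norm (x - y))\<^sup>2"
      using assms(2) xy unfolding s_convex_iff_real[where \<phi>=\<phi>, OF nm] by blast+
    show "?w \<in> eff_dom \<phi> \<and> real_of_ereal (?G ?w) \<le> (1 - l) * real_of_ereal (?G x)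
        + l * real_of_ereal (?G y) - (s + r) / 2 * l * (1 - l) * (norm (x - y))\<^sup>2"
      unfolding val[OF w(1)] val[OF xy(1)] val[OF xy(2)] unfolding sq
      using w by (simp add: algebra_simps add_divide_distrib diff_divide_distrib)
  qed
qed

text \<open>Coercivity has to be derived. A lower bound on the unit ball around x0, carried outward
  along rays by strong convexity, shows that far points have values above \<open>g x0\<close>; a
  minimizer over a large ball is then global.\<close>

lemma strongly_convex_attains_inf:
  fixes G :: "'a::euclidean_space \<Rightarrow> ereal"
  assumes nm: "\<And>x. G x \<noteq> -\<infinity>" and proper: "proper_fun G" and lsc: "lower_semicontinuous G"
    and conv: "s_convex \<sigma> G" and \<sigma>: "\<sigma> > 0"
  obtains p where "p \<in> eff_dom G" "\<And>y. y \<in> eff_dom G \<Longrightarrow>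
    real_of_ereal (G p) + \<sigma> / 2 * (norm (y - p))\<^sup>2 \<le> real_of_ereal (G y)"
proof -
  define S where "S = eff_dom G"
  define g where "g x = real_of_ereal (G x)" for x
  have G: "G x = ereal (g x)" if "x \<in> S" for x
    using that unfolding S_def g_def by (rule eff_dom_ereal[where \<phi>=G, OF nm])
  have G': "G x = \<infinity>" if "x \<notin> S" for x
    using not_eff_dom that by (simp add: S_def)
  have conv': "(1 - l) *\<^sub>R x + l *\<^sub>R y \<in> S"
    "g ((1 - l) *\<^sub>R x + l *\<^sub>R y) \<le> (1 - l) * g x + l * g y - \<sigma> / 2 * l * (1 - l) * (norm (x - y))\<^sup>2"
    if "x \<in> S" "y \<in> S" "0 < l" "l < 1" for x y l
    using conv[unfolded s_convex_iff_real[where \<phi>=G, OF nm], folded S_def g_def,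
        THEN bspec, OF that(1), THEN bspec, OF that(2), THEN bspec, of l] that(3,4)
    by simp_all
  obtain x0 where x0: "x0 \<in> S"
    using proper by (auto simp: proper_fun_def S_def)
  obtain b where b: "b \<in> cball x0 1" "\<And>y. y \<in> cball x0 1 \<Longrightarrow> G b \<le> G y"
    using lower_semicontinuous_attains_inf[OF lsc compact_cball[of x0 1]] by auto
  have bS: "b \<in> S"
  proof (rule ccontr)
    assume "b \<notin> S"
    with b(2)[of x0] show False by (simp add: G' G[OF x0])
  qed
  have m: "g b \<le> g y" if "y \<in> S" "y \<in> cball x0 1" for y
    using b(2)[OF that(2)] G[OF that(1)] G[OF bS] by simp
  \<comment> \<open>Chosen so that d > R implies \<open>\<sigma>\<close> / 2 (d - 1) > g x0 - g b,
    which makes the quadratic term dominate.\<close>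
  define R where "R = 1 + 2 * (g x0 - g b) / \<sigma>"
  have R: "R \<ge> 1"
    using m[OF x0] \<sigma> by (simp add: R_def)
  obtain p where p: "p \<in> cball x0 R" "\<And>y. y \<in> cball x0 R \<Longrightarrow> G p \<le> G y"
    using lower_semicontinuous_attains_inf[OF lsc compact_cball[of x0 R]] R by auto
  have "G p \<le> G x0" using p(2)[of x0] R by simp
  then have pS: "p \<in> S"
    by (metis G G' x0 ereal_infty_less_eq(1) PInfty_neq_ereal(1))
  have p_x0: "g p \<le> g x0"
    using \<open>G p \<le> G x0\<close> G[OF x0] G[OF pS] by simp
  have min: "g p \<le> g y" if y: "y \<in> S" for y
  proof (cases "y \<in> cball x0 R")
    case True
    then show ?thesis using p(2)[OF True] G[OF y] G[OF pS] by simp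
  next
    case False
    define d where "d = norm (y - x0)"
    have d: "d > R" "d > 1"
      using False R by (auto simp: d_def dist_norm norm_minus_commute)
    have dd: "norm (x0 - y) = d" and d0: "d \<noteq> 0"
      using d by (auto simp: d_def norm_minus_commute)
    \<comment> \<open>The point at distance 1 from x0 on the segment to y, where the bound
      \<open>g b\<close> is available.\<close>
    define w where "w = (1 - 1 / d) *\<^sub>R x0 + (1 / d) *\<^sub>R y"
    have "w - x0 = (1 / d) *\<^sub>R (y - x0)"
      by (simp add: w_def algebra_simps)
    then have "norm (w - x0) = 1"
      using d by (auto simp: d_def)
    then have w1: "w \<in> cball x0 1"
      by (simp add: dist_norm norm_minus_commute)
    have w: "w \<in> S" "g w \<le> (1 - 1 / d) * g x0 + 1 / d * g y - \<sigma> / 2 * (1 / d) * (1 - 1 / d) * d\<^sup>2"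
      using conv'[OF x0 y, of "1 / d"] d by (simp_all add: w_def dd)
    from m[OF w(1) w1] this(2) have "g b \<le> (1 - 1 / d) * g x0 + 1 / d * g y - \<sigma> / 2 * (1 / d) * (1 - 1 / d) * d\<^sup>2"
      by (rule order_trans)
    then have "d * g b \<le> d * ((1 - 1 / d) * g x0 + 1 / d * g y - \<sigma> / 2 * (1 / d) * (1 - 1 / d) * d\<^sup>2)"
      using d by (intro mult_left_mono) auto
    also have "\<dots> = (d - 1) * g x0 + g y - d * (\<sigma> / 2 * (d - 1))"
      using d0 by (simp add: field_simps power2_eq_square)
    finally have "g x0 + d * (\<sigma> / 2 * (d - 1) - (g x0 - g b)) \<le> g y"
      by (simp add: algebra_simps)
    moreover have "g x0 - g b \<le> \<sigma> / 2 * (d - 1)"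
      using d(1) \<sigma> by (simp add: R_def field_simps)
    then have "0 \<le> d * (\<sigma> / 2 * (d - 1) - (g x0 - g b))"
      using d by (intro mult_nonneg_nonneg) auto
    ultimately show ?thesis using p_x0 by linarith
  qed
  \<comment> \<open>Compare p with the points of the segment from p to y, divide by the weight l of
    y, and let l tend to 0.\<close>
  have "g p + \<sigma> / 2 * (norm (y - p))\<^sup>2 \<le> g y" if y: "y \<in> S" for y
  proof (rule tendsto_upperbound)
    show "((\<lambda>l. g p + \<sigma> / 2 * (1 - l) * (norm (y - p))\<^sup>2) \<longlongrightarrow> g p + \<sigma> / 2 * (norm (y - p))\<^sup>2) (at_right 0)"
      by (auto intro!: tendsto_eq_intros)
    have "g p + \<sigma> / 2 * (1 - l) * (norm (y - p))\<^sup>2 \<le> g y" if l: "0 < l" "l < 1" for l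
    proof -
      have "g p \<le> (1 - l) * g p + l * g y - \<sigma> / 2 * l * (1 - l) * (norm (p - y))\<^sup>2"
        by (rule order_trans[OF min[OF conv'(1)[OF pS y l]] conv'(2)[OF pS y l]])
      then have "l * (g p + \<sigma> / 2 * (1 - l) * (norm (y - p))\<^sup>2) \<le> l * g y"
        by (simp add: algebra_simps norm_minus_commute)
      then show ?thesis using l by simp
    qed
    then show "\<forall>\<^sub>F l in at_right 0. g p + \<sigma> / 2 * (1 - l) * (norm (y - p))\<^sup>2 \<le> g y"
      unfolding eventually_at_right_field by (intro exI[of _ 1]) auto
  qed auto
  then show thesis
    using pS unfolding S_def g_def by (rule that[rotated])
qed

section \<open>Proximal maps and Moreau envelopes\<close>

lemma has_derivative_right_quotient:
  assumes F: "(F has_derivative B) (at z)"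
  shows "((\<lambda>t. (F (z + t *\<^sub>R h) - F z) /\<^sub>R t) \<longlongrightarrow> B h) (at_right 0)"
proof -
  interpret B: bounded_linear B
    using F by (rule has_derivative_bounded_linear)
  have "((\<lambda>t. F (z + t *\<^sub>R h)) has_derivative (\<lambda>t. B (t *\<^sub>R h))) (at 0)"
    by (rule has_derivative_compose[where g=F]) (auto intro!: derivative_eq_intros F)
  then have "((\<lambda>t. norm (F (z + t *\<^sub>R h) - F z - t *\<^sub>R B h) / norm t) \<longlongrightarrow> 0) (at_right 0)"
    by (auto simp: has_derivative_at B.scaleR intro: tendsto_mono[OF at_le])
  moreover have "\<forall>\<^sub>F t in at_right 0. norm (F (z + t *\<^sub>R h) - F z - t *\<^sub>R B h) / norm t
      = norm ((F (z + t *\<^sub>R h) - F z) /\<^sub>R t - B h)"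
    unfolding eventually_at_right_field
  proof (intro exI[of _ 1] conjI allI impI)
    fix t :: real assume t: "0 < t" "t < 1"
    then have "(F (z + t *\<^sub>R h) - F z) /\<^sub>R t - B h = (F (z + t *\<^sub>R h) - F z - t *\<^sub>R B h) /\<^sub>R t"
      by (simp add: scaleR_right_diff_distrib)
    then show "norm (F (z + t *\<^sub>R h) - F z - t *\<^sub>R B h) / norm t
      = norm ((F (z + t *\<^sub>R h) - F z) /\<^sub>R t - B h)"
      using t by (simp add: divide_inverse_commute)
  qed simp
  ultimately have "((\<lambda>t. norm ((F (z + t *\<^sub>R h) - F z) /\<^sub>R t - B h)) \<longlongrightarrow> 0) (at_right 0)"
    by (rule Lim_transform_eventually)
  then show ?thesis
    by (rule LIM_zero_cancel[OF tendsto_norm_zero_cancel])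
qed

text \<open>P is the proximal map of f on its domain S; the growth inequality is what strong convexity, with
  modulus \<^term>\<open>\<sigma>\<close>, of the penalized function says at its minimizer.\<close>

locale prox_map =
  fixes S :: "'a::euclidean_space set" and f :: "'a \<Rightarrow> real" and r \<sigma> :: real and P :: "'a \<Rightarrow> 'a"
  assumes r: "r > 0" and \<sigma>: "\<sigma> > 0" and P_in: "P z \<in> S"
    and growth: "y \<in> S \<Longrightarrow>
      f (P z) + r / 2 * (norm (P z - z))\<^sup>2 + \<sigma> / 2 * (norm (y - P z))\<^sup>2 \<le> f y + r / 2 * (norm (y - z))\<^sup>2"
begin

definition envelope :: "'a \<Rightarrow> real" where
  "envelope z = f (P z) + r / 2 * (norm (P z - z))\<^sup>2"

lemma envelope_le: "y \<in> S \<Longrightarrow> envelope z \<le> f y + r / 2 * (norm (y - z))\<^sup>2"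
proof -
  assume "y \<in> S"
  moreover have "0 \<le> \<sigma> / 2 * (norm (y - P z))\<^sup>2"
    using \<sigma> by simp
  ultimately show ?thesis
    using growth[of y z] by (simp add: envelope_def)
qed

lemma envelope_le_self: "y \<in> S \<Longrightarrow> envelope y \<le> f y"
  using envelope_le[of y y] by simp

text \<open>Add the growth inequalities at z and z', each tested at the other minimizer: the values
  of f cancel and the squares combine to an inner product.\<close>

lemma prox_monotone: "\<sigma> * (norm (P z - P z'))\<^sup>2 \<le> r * ((z - z') \<bullet> (P z - P z'))"
proof -
  have "\<sigma> * (norm (P z - P z'))\<^sup>2 \<le> r / 2 * ((norm (P z' - z))\<^sup>2 - (norm (P z - z))\<^sup>2
      + (norm (P z - z'))\<^sup>2 - (norm (P z' - z'))\<^sup>2)"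
    using growth[OF P_in, of z z'] growth[OF P_in, of z' z]
    by (simp add: norm_minus_commute algebra_simps)
  also have "\<dots> = r * ((z - z') \<bullet> (P z - P z'))"
    unfolding power2_norm_eq_inner by (simp add: inner_simps inner_commute field_simps)
  finally show ?thesis .
qed

lemma prox_lipschitz: "(r / \<sigma>)-lipschitz_on UNIV P"
proof (rule lipschitz_onI)
  fix x y
  let ?n = "norm (P x - P y)"
  have "\<sigma> * ?n\<^sup>2 \<le> r * (norm (x - y) * ?n)"
    by (rule order_trans[OF prox_monotone])
      (use r in \<open>intro mult_left_mono norm_cauchy_schwarz; simp\<close>)
  then have "?n * (\<sigma> * ?n) \<le> ?n * (r * norm (x - y))"
    by (simp add: power2_eq_square mult_ac)
  then have "\<sigma> * ?n \<le> r * norm (x - y)"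
    using r by (cases "?n = 0") auto
  then show "dist (P x) (P y) \<le> r / \<sigma> * dist x y"
    using \<sigma> by (simp add: dist_norm field_simps)
qed (use r \<sigma> in simp)

lemma prox_norm_diff_le: "norm (P x - P y) \<le> r / \<sigma> * norm (x - y)"
  using lipschitz_onD[OF prox_lipschitz, of x y] by (simp add: dist_norm)

text \<open>P z is a competitor in the minimization defining the envelope at y; expanding its
  squared distance to y about z gives the right-hand side.\<close>

lemma envelope_upper:
  "envelope y \<le> envelope z + r * ((z - P z) \<bullet> (y - z)) + r / 2 * (norm (y - z))\<^sup>2"
proof -
  have "envelope y \<le> f (P z) + r / 2 * (norm (P z - y))\<^sup>2"
    by (rule envelope_le[OF P_in])
  also have "\<dots> = envelope z + r * ((z - P z) \<bullet> (y - z)) + r / 2 * (norm (y - z))\<^sup>2"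
    unfolding power2_norm_eq_inner envelope_def by (simp add: inner_simps inner_commute field_simps)
  finally show ?thesis .
qed

text \<open>Exchanging y and z in \<open>envelope_upper\<close> gives a matching lower bound, but
  with the gradient at y. The Lipschitz bound on P moves it to z at a quadratic cost, so the total
  error is of order |y - z|^2.\<close>

lemma envelope_has_derivative: "(envelope has_derivative (\<lambda>h. r * ((z - P z) \<bullet> h))) (at z)"
proof (rule has_derivativeI_sandwich[where e=1 and H="\<lambda>y. r * (2 + r / \<sigma>) * norm (y - z)"])
  show "bounded_linear (\<lambda>h. r * ((z - P z) \<bullet> h))"
    by (intro bounded_linear_const_mult bounded_linear_inner_right)
  have "((\<lambda>y. r * (2 + r / \<sigma>) * norm (y - z)) \<longlongrightarrow> r * (2 + r / \<sigma>) * norm (z - z)) (at z)"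
    by (intro tendsto_intros)
  then show "((\<lambda>y. r * (2 + r / \<sigma>) * norm (y - z)) \<longlongrightarrow> 0) (at z)"
    by simp
  fix y assume "y \<noteq> z"
  have "\<bar>(P y - P z) \<bullet> (y - z)\<bar> \<le> norm (P y - P z) * norm (y - z)"
    by (rule Cauchy_Schwarz_ineq2)
  also have "\<dots> \<le> (r / \<sigma> * norm (y - z)) * norm (y - z)"
    by (intro mult_right_mono prox_norm_diff_le) auto
  finally have "r * \<bar>(P y - P z) \<bullet> (y - z)\<bar> \<le> r * (r / \<sigma> * (norm (y - z))\<^sup>2)"
    using r by (intro mult_left_mono) (auto simp: power2_eq_square)
  moreover have "r * ((P y - P z) \<bullet> (y - z)) \<le> r * \<bar>(P y - P z) \<bullet> (y - z)\<bar>"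
    using r by (intro mult_left_mono) auto
  moreover have "envelope z \<le> envelope y - r * ((y - P y) \<bullet> (y - z)) + r / 2 * (norm (y - z))\<^sup>2"
    using envelope_upper[of z y] by (simp add: inner_simps algebra_simps norm_minus_commute)
  moreover have "r * ((y - P y) \<bullet> (y - z)) = r * ((z - P z) \<bullet> (y - z)) + r * (norm (y - z))\<^sup>2
      - r * ((P y - P z) \<bullet> (y - z))"
    unfolding power2_norm_eq_inner by (simp add: inner_simps algebra_simps)
  moreover have "0 \<le> r * (norm (y - z))\<^sup>2" "0 \<le> r * (r / \<sigma> * (norm (y - z))\<^sup>2)"
    using r \<sigma> by auto
  ultimately have "\<bar>envelope y - envelope z - r * ((z - P z) \<bullet> (y - z))\<bar>
      \<le> 2 * (r * (norm (y - z))\<^sup>2) + r * (r / \<sigma> * (norm (y - z))\<^sup>2)"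
    using envelope_upper[of y z] by (simp add: abs_le_iff)
  also have "\<dots> = r * (2 + r / \<sigma>) * norm (y - z) * norm (y - z)"
    by (simp add: algebra_simps power2_eq_square)
  finally show "norm (envelope y - envelope z - r * ((z - P z) \<bullet> (y - z))) / norm (y - z)
      \<le> r * (2 + r / \<sigma>) * norm (y - z)"
    using \<open>y \<noteq> z\<close> by (simp add: divide_le_eq)
qed auto

lemma envelope_line_derivative:
  "((\<lambda>t. envelope (z + t *\<^sub>R d)) has_real_derivative r * ((z + t *\<^sub>R d - P (z + t *\<^sub>R d)) \<bullet> d)) (at t)"
proof -
  have "((\<lambda>t. envelope (z + t *\<^sub>R d)) has_derivative
      (\<lambda>h. r * ((z + t *\<^sub>R d - P (z + t *\<^sub>R d)) \<bullet> (h *\<^sub>R d)))) (at t)"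
    by (rule has_derivative_compose[OF _ envelope_has_derivative])
      (auto intro!: derivative_eq_intros)
  then show ?thesis
    unfolding has_field_derivative_def by (rule has_derivative_eq_rhs) (auto simp: mult_ac)
qed

text \<open>P is differentiable only at z, so the envelope cannot be differentiated twice nearby.
  Its gradient exists everywhere, however, and the mean value theorem applied to the remainder
  reduces the claim to the first-order expansion of P at z.\<close>

lemma envelope_second_order:
  assumes B: "(P has_derivative B) (at z)"
  shows "((\<lambda>t. (envelope (z + t *\<^sub>R h) - envelope z - t * (r * ((z - P z) \<bullet> h))) / (t\<^sup>2 / 2))
    \<longlongrightarrow> r * ((norm h)\<^sup>2 - B h \<bullet> h)) (at_right 0)"
proof (rule tendstoI)
  fix e :: real assume e: "e > 0"
  from has_derivative_right_quotient[OF B]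
  have "((\<lambda>t. ((P (z + t *\<^sub>R h) - P z) /\<^sub>R t) \<bullet> h) \<longlongrightarrow> B h \<bullet> h) (at_right 0)"
    by (intro tendsto_intros)
  then have "\<forall>\<^sub>F t in at_right 0. dist (((P (z + t *\<^sub>R h) - P z) /\<^sub>R t) \<bullet> h) (B h \<bullet> h) < e / (2 * r)"
    using e r by (intro tendstoD) auto
  then obtain \<delta> where \<delta>: "\<delta> > 0" "\<And>t. 0 < t \<Longrightarrow> t < \<delta> \<Longrightarrow>
      \<bar>((P (z + t *\<^sub>R h) - P z) /\<^sub>R t) \<bullet> h - B h \<bullet> h\<bar> < e / (2 * r)"
    unfolding eventually_at_right_field dist_real_def by blast
  define c where "c = r * ((norm h)\<^sup>2 - B h \<bullet> h)"
  \<comment> \<open>g t - g 0 is the remainder of the expected quadratic expansion. The tolerance e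
    / (2 r) makes |g' s| < s e / 2, hence |g t - g 0| < e t^2 / 2.\<close>
  define g where "g t = envelope (z + t *\<^sub>R h) - t * (r * ((z - P z) \<bullet> h)) - t\<^sup>2 / 2 * c" for t
  define g' where "g' t = r * ((z + t *\<^sub>R h - P (z + t *\<^sub>R h)) \<bullet> h) - r * ((z - P z) \<bullet> h) - t * c" for t
  have g': "(g has_real_derivative g' t) (at t)" for t
    unfolding g_def g'_def by (auto intro!: derivative_eq_intros envelope_line_derivative)
  have "dist ((envelope (z + t *\<^sub>R h) - envelope z - t * (r * ((z - P z) \<bullet> h))) / (t\<^sup>2 / 2)) c < e"
    if t: "0 < t" "t < \<delta>" for t
  proof -
    obtain s where s: "0 < s" "s < t" "g t - g 0 = (t - 0) * g' s"
      using MVT2[OF t(1), of g g'] g' by auto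
    have "g' s = - (r * s * (((P (z + s *\<^sub>R h) - P z) /\<^sub>R s) \<bullet> h - B h \<bullet> h))"
    proof -
      have "s * (((P (z + s *\<^sub>R h) - P z) /\<^sub>R s) \<bullet> h) = (P (z + s *\<^sub>R h) - P z) \<bullet> h"
        using s(1) by simp
      then have "r * s * (((P (z + s *\<^sub>R h) - P z) /\<^sub>R s) \<bullet> h - B h \<bullet> h)
          = r * ((P (z + s *\<^sub>R h) - P z) \<bullet> h) - r * s * (B h \<bullet> h)"
        by (simp add: right_diff_distrib mult.assoc)
      then show ?thesis
        unfolding g'_def c_def power2_norm_eq_inner by (simp add: inner_simps algebra_simps)
    qed
    then have "\<bar>g' s\<bar> = r * s * \<bar>((P (z + s *\<^sub>R h) - P z) /\<^sub>R s) \<bullet> h - B h \<bullet> h\<bar>"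
      using r s(1) by (simp add: abs_mult)
    also have "\<dots> < r * s * (e / (2 * r))"
      using \<delta>(2)[of s] s t r by (intro mult_strict_left_mono) auto
    also have "\<dots> = s * e / 2"
      using r by simp
    also have "\<dots> \<le> t * e / 2"
      using s e by simp
    finally have "\<bar>g t - g 0\<bar> < t * (t * e / 2)"
      using s(3) t by (simp add: abs_mult)
    also have "\<dots> = e * (t\<^sup>2 / 2)"
      by (simp add: power2_eq_square)
    finally have "\<bar>g t - g 0\<bar> < e * \<bar>t\<^sup>2 / 2\<bar>"
      by simp
    then have "\<bar>(g t - g 0) / (t\<^sup>2 / 2)\<bar> < e"
      unfolding abs_divide[of "g t - g 0"] using t(1) by (subst pos_divide_less_eq) auto
    moreover have "(envelope (z + t *\<^sub>R h) - envelope z - t * (r * ((z - P z) \<bullet> h))) / (t\<^sup>2 / 2) - c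
        = (g t - g 0) / (t\<^sup>2 / 2)"
      using t by (simp add: g_def field_simps)
    ultimately show ?thesis
      by (simp only: dist_real_def)
  qed
  then show "\<forall>\<^sub>F t in at_right 0. dist ((envelope (z + t *\<^sub>R h) - envelope z - t * (r * ((z - P z) \<bullet> h))) / (t\<^sup>2 / 2))
      (r * ((norm h)\<^sup>2 - B h \<bullet> h)) < e"
    using \<delta>(1) unfolding eventually_at_right_field c_def by blast
qed

text \<open>The hypothesis \<open>ne\<close> says that z - P z is monotone in z, so the slope of the
  envelope along a segment is nowhere below its initial slope; the mean value theorem
  concludes.\<close>

lemma envelope_above_tangent:
  assumes ne: "\<And>z d. (P (z + d) - P z) \<bullet> d \<le> (norm d)\<^sup>2"
  shows "envelope z + r * ((z - P z) \<bullet> (y - z)) \<le> envelope y"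
proof -
  let ?d = "y - z"
  obtain s where s: "0 < s" "s < 1"
    "envelope (z + 1 *\<^sub>R ?d) - envelope (z + 0 *\<^sub>R ?d)
       = (1 - 0) * (r * ((z + s *\<^sub>R ?d - P (z + s *\<^sub>R ?d)) \<bullet> ?d))"
    using MVT2[of 0 1 "\<lambda>t. envelope (z + t *\<^sub>R ?d)" "\<lambda>t. r * ((z + t *\<^sub>R ?d - P (z + t *\<^sub>R ?d)) \<bullet> ?d)"]
      envelope_line_derivative by auto
  have "s * ((P (z + s *\<^sub>R ?d) - P z) \<bullet> ?d) \<le> s * (s * (norm ?d)\<^sup>2)"
    using ne[of z "s *\<^sub>R ?d"] s(1) by (simp add: power2_eq_square mult_ac)
  then have "(P (z + s *\<^sub>R ?d) - P z) \<bullet> ?d \<le> s * (norm ?d)\<^sup>2"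
    using s(1) by simp
  then have "(z - P z) \<bullet> ?d \<le> (z + s *\<^sub>R ?d - P (z + s *\<^sub>R ?d)) \<bullet> ?d"
    by (simp add: inner_add_left inner_diff_left power2_norm_eq_inner)
  then have "r * ((z - P z) \<bullet> ?d) \<le> r * ((z + s *\<^sub>R ?d - P (z + s *\<^sub>R ?d)) \<bullet> ?d)"
    using r by simp
  with s(3) show ?thesis by simp
qed

lemma envelope_convex:
  assumes ne: "\<And>z d. (P (z + d) - P z) \<bullet> d \<le> (norm d)\<^sup>2" and l: "0 < l" "l < 1"
  shows "envelope ((1 - l) *\<^sub>R x + l *\<^sub>R y) \<le> (1 - l) * envelope x + l * envelope y"
proof -
  define w where "w = (1 - l) *\<^sub>R x + l *\<^sub>R y"
  let ?v = "w - P w"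
  have "(1 - l) * (envelope w + r * (?v \<bullet> (x - w))) \<le> (1 - l) * envelope x"
    "l * (envelope w + r * (?v \<bullet> (y - w))) \<le> l * envelope y"
    using envelope_above_tangent[OF ne, of w] l by (auto intro!: mult_left_mono)
  moreover have "(1 - l) * (envelope w + r * (?v \<bullet> (x - w))) + l * (envelope w + r * (?v \<bullet> (y - w)))
      = envelope w + r * (?v \<bullet> ((1 - l) *\<^sub>R (x - w) + l *\<^sub>R (y - w)))"
    unfolding inner_add_right inner_scaleR_right by (simp add: algebra_simps)
  moreover have "(1 - l) *\<^sub>R (x - w) + l *\<^sub>R (y - w) = 0"
    by (simp add: w_def algebra_simps)
  ultimately have "envelope w \<le> (1 - l) * envelope x + l * envelope y"
    by simp
  then show ?thesis by (simp add: w_def)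
qed

text \<open>Nonexpansiveness of the derivative at almost every point passes to the map itself by
  integrating along almost every translate of a given segment.\<close>

lemma prox_inner_le:
  assumes "AE z in lborel. \<forall>B. (P has_derivative B) (at z) \<longrightarrow> (\<forall>h. norm (B h) \<le> norm h)"
  shows "(P (z + d) - P z) \<bullet> d \<le> (norm d)\<^sup>2"
proof -
  have "AE z in lborel. \<exists>B. (P has_derivative B) (at z) \<and> (\<forall>h. norm (B h) \<le> norm h)"
    using assms Rademacher[OF prox_lipschitz] by eventually_elim (auto simp: differentiable_def)
  \<comment> \<open>N is a Borel null set containing all bad points; its complement meets the
    measurability condition of \<open>AE_lborel_lines\<close>.\<close>
  then obtain N where N: "N \<in> null_sets lborel"
    "\<And>z. z \<notin> N \<Longrightarrow> \<exists>B. (P has_derivative B) (at z) \<and> (\<forall>h. norm (B h) \<le> norm h)"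
    by (rule AE_E3) auto
  have "- N \<in> sets borel"
    using N(1) by auto
  then have "AE x in lborel. AE t in lborel. x + t *\<^sub>R d \<in> - N"
    by (subst AE_lborel_lines) (use AE_not_in[OF N(1)] in simp_all)
  moreover have "(P (x + d) - P x) \<bullet> d \<le> (norm d)\<^sup>2" if ae: "AE t in lborel. x + t *\<^sub>R d \<in> - N" for x
  proof -
    define g where "g t = P (x + t *\<^sub>R d) \<bullet> d" for t
    have "\<bar>g s - g t\<bar> \<le> (r / \<sigma> * norm d * norm d) * \<bar>s - t\<bar>" for s t
    proof -
      have "\<bar>g s - g t\<bar> \<le> norm (P (x + s *\<^sub>R d) - P (x + t *\<^sub>R d)) * norm d"
        unfolding g_def inner_diff_left[symmetric] by (rule Cauchy_Schwarz_ineq2)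
      also have "\<dots> \<le> (r / \<sigma> * norm ((x + s *\<^sub>R d) - (x + t *\<^sub>R d))) * norm d"
        by (intro mult_right_mono prox_norm_diff_le) auto
      also have "(x + s *\<^sub>R d) - (x + t *\<^sub>R d) = (s - t) *\<^sub>R d"
        by (simp add: algebra_simps)
      finally show ?thesis by (simp add: mult_ac)
    qed
    then obtain D M where M: "negligible M"
      and int: "\<And>a b. a \<le> b \<Longrightarrow> (D has_integral g b - g a) {a..b}"
      and lim: "\<And>t. t \<notin> M \<Longrightarrow> ((\<lambda>h. (g (t + h) - g t) / h) \<longlongrightarrow> D t) (at_right 0)"
      by (rule Lipschitz_right_derivative) (rule that)
    have D_le: "D t \<le> (norm d)\<^sup>2" if t: "t \<notin> M" "x + t *\<^sub>R d \<notin> N" for t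
    proof -
      obtain B where B: "(P has_derivative B) (at (x + t *\<^sub>R d))" "norm (B d) \<le> norm d"
        using N(2)[OF t(2)] by blast
      have "(g has_derivative (\<lambda>h. B (h *\<^sub>R d) \<bullet> d)) (at t)"
        unfolding g_def
        by (rule has_derivative_compose[where g=P, THEN has_derivative_inner_left[rotated]])
          (auto intro!: derivative_eq_intros B)
      then have "(g has_real_derivative B d \<bullet> d) (at t)"
        unfolding has_field_derivative_def
        using linear_scale[OF has_derivative_linear[OF B(1)]] by (simp add: mult.commute[of _ "B d \<bullet> d"])
      then have "((\<lambda>h. (g (t + h) - g t) / h) \<longlongrightarrow> B d \<bullet> d) (at_right 0)"
        by (auto simp: DERIV_def intro: tendsto_mono[OF at_le])
      then have "D t = B d \<bullet> d"
        by (rule tendsto_unique[OF trivial_limit_at_right_real lim[OF t(1)]])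
      also have "\<dots> \<le> norm (B d) * norm d"
        by (rule norm_cauchy_schwarz)
      also have "\<dots> \<le> norm d * norm d"
        using B(2) by (rule mult_right_mono) auto
      finally show ?thesis by (simp add: power2_eq_square)
    qed
    have neg: "negligible (M \<union> {t. x + t *\<^sub>R d \<in> N})"
      using M ae by (simp add: AE_lborel_iff_negligible)
    have "g 1 - g 0 \<le> (norm d)\<^sup>2"
    proof (rule has_integral_le)
      \<comment> \<open>E changes D on a null set so that the bound holds at every t, as
        \<open>has_integral_le\<close> demands.\<close>
      define E where "E t = (if t \<in> M \<union> {t. x + t *\<^sub>R d \<in> N} then (norm d)\<^sup>2 else D t)" for t
      have "(D has_integral g 1 - g 0) {0..1}"
        by (rule int) simp
      then show "(E has_integral g 1 - g 0) {0..1}"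
        by (rule has_integral_spike[OF neg, rotated]) (simp add: E_def)
      show "((\<lambda>_. (norm d)\<^sup>2) has_integral (norm d)\<^sup>2) {0..1::real}"
        using has_integral_const_real[of "(norm d)\<^sup>2" 0 1] by simp
      show "E t \<le> (norm d)\<^sup>2" for t
        using D_le[of t] by (auto simp: E_def)
    qed
    then show ?thesis
      by (simp add: g_def inner_diff_left)
  qed
  ultimately have "AE x in lborel. (P (x + d) - P x) \<bullet> d \<le> (norm d)\<^sup>2"
    by (auto elim: eventually_mono)
  then have "negligible {x. \<not> (P (x + d) - P x) \<bullet> d \<le> (norm d)\<^sup>2}"
    by (simp only: AE_lborel_iff_negligible)
  \<comment> \<open>An open null set is empty, so the inequality, so far known for almost every x,
    holds for every x.\<close>
  moreover have "open {x. \<not> (P (x + d) - P x) \<bullet> d \<le> (norm d)\<^sup>2}"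
  proof -
    have P: "continuous_on UNIV P"
      by (rule lipschitz_on_continuous_on[OF prox_lipschitz])
    then have "continuous_on UNIV (\<lambda>x. P (x + d))"
      by (rule continuous_on_compose2) (auto intro!: continuous_intros)
    with P show ?thesis
      unfolding not_le by (intro open_Collect_less continuous_intros)
  qed
  ultimately have "{x. \<not> (P (x + d) - P x) \<bullet> d \<le> (norm d)\<^sup>2} = {}"
    using open_not_negligible by blast
  then show ?thesis by blast
qed

end

section \<open>Subgradients and second subderivatives\<close>

text \<open>The segment from z to y stays in C and the normal quotient is constant along it, equal
  to a. A positive a would contradict the upper limit at z.\<close>

lemma regular_normal_cone_convex:
  assumes "convex C" "z \<in> C" "y \<in> C" and v: "v \<in> regular_normal_cone C z"
  shows "v \<bullet> (y - z) \<le> 0"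
proof (rule ccontr)
  assume pos: "\<not> v \<bullet> (y - z) \<le> 0"
  then have "y \<noteq> z" by auto
  define a where "a = v \<bullet> (y - z) / norm (y - z)"
  have "a > 0"
    using pos \<open>y \<noteq> z\<close> by (simp add: a_def)
  then have "Limsup (at z within C) (\<lambda>y. ereal (v \<bullet> (y - z) / norm (y - z))) < ereal a"
    using v by (auto simp: regular_normal_cone_def intro: le_less_trans)
  then have "\<forall>\<^sub>F y in at z within C. ereal (v \<bullet> (y - z) / norm (y - z)) < ereal a"
    by (rule Limsup_lessD)
  then obtain d where d: "d > 0" "\<And>x. x \<in> C \<Longrightarrow> x \<noteq> z \<Longrightarrow> dist x z < d \<Longrightarrow> v \<bullet> (x - z) / norm (x - z) < a"
    by (auto simp: eventually_at)
  define t where "t = min 1 (d / (2 * norm (y - z)))"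
  have t: "0 < t" "t \<le> 1" "t * norm (y - z) < d"
  proof -
    show "0 < t" "t \<le> 1"
      using d(1) \<open>y \<noteq> z\<close> by (auto simp: t_def)
    have "t * norm (y - z) \<le> d / (2 * norm (y - z)) * norm (y - z)"
      by (intro mult_right_mono) (auto simp: t_def)
    also have "\<dots> < d"
      using d(1) \<open>y \<noteq> z\<close> by simp
    finally show "t * norm (y - z) < d" .
  qed
  have "z + t *\<^sub>R (y - z) = (1 - t) *\<^sub>R z + t *\<^sub>R y"
    by (simp add: algebra_simps)
  then have "z + t *\<^sub>R (y - z) \<in> C"
    using convexD_alt[OF assms(1-3), of t] t by simp
  from d(2)[OF this] show False
    using t \<open>y \<noteq> z\<close> by (simp add: a_def dist_norm)
qed

lemma mem_epi_iff:
  assumes "\<phi> x \<noteq> -\<infinity>"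
  shows "(x, \<alpha>) \<in> epi \<phi> \<longleftrightarrow> x \<in> eff_dom \<phi> \<and> real_of_ereal (\<phi> x) \<le> \<alpha>"
  using assms by (cases "\<phi> x") (auto simp: epi_def eff_dom_def)

lemma convex_epi:
  assumes nm: "\<And>x. \<phi> x \<noteq> -\<infinity>" and "convex_fun \<phi>"
  shows "convex (epi \<phi>)"
  unfolding convex_alt
proof (intro ballI allI impI)
  fix p q and l :: real assume p: "p \<in> epi \<phi>" and q: "q \<in> epi \<phi>" and l: "0 \<le> l \<and> l \<le> 1"
  obtain x a y b where pq: "p = (x, a)" "q = (y, b)"
    by (cases p, cases q)
  consider "l = 0" | "l = 1" | "0 < l" "l < 1"
    using l by linarith
  then show "(1 - l) *\<^sub>R p + l *\<^sub>R q \<in> epi \<phi>"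
  proof cases
    case 3
    have x: "x \<in> eff_dom \<phi>" "real_of_ereal (\<phi> x) \<le> a" and y: "y \<in> eff_dom \<phi>" "real_of_ereal (\<phi> y) \<le> b"
      using p q unfolding pq mem_epi_iff[where \<phi>=\<phi>, OF nm] by auto
    have "(1 - l) *\<^sub>R x + l *\<^sub>R y \<in> eff_dom \<phi> \<and> real_of_ereal (\<phi> ((1 - l) *\<^sub>R x + l *\<^sub>R y))
      \<le> (1 - l) * real_of_ereal (\<phi> x) + l * real_of_ereal (\<phi> y) - 0 / 2 * l * (1 - l) * (norm (x - y))\<^sup>2"
      using assms(2) x(1) y(1) 3 unfolding convex_fun_def s_convex_iff_real[where \<phi>=\<phi>, OF nm] 
      by (meson greaterThanLessThan_iff)
    moreover have "(1 - l) * real_of_ereal (\<phi> x) + l * real_of_ereal (\<phi> y) \<le> (1 - l) * a + l * b"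
      using x(2) y(2) 3 by (intro add_mono mult_left_mono) auto
    ultimately show ?thesis
      unfolding pq by (simp add: mem_epi_iff[where \<phi>=\<phi>, OF nm])
  qed (use p q in auto)
qed

text \<open>The global inequality for regular normals of the convex epigraph survives the limit that
  defines limiting normals; the last component -1 turns it into the subgradient inequality.\<close>

lemma convex_fun_subgradient:
  assumes nm: "\<And>x. \<phi> x \<noteq> -\<infinity>" and conv: "convex_fun \<phi>"
    and v: "v \<in> subdifferential \<phi> x" and y: "y \<in> eff_dom \<phi>"
  shows "v \<bullet> (y - x) \<le> real_of_ereal (\<phi> y) - real_of_ereal (\<phi> x)"
proof -
  let ?x = "(x, real_of_ereal (\<phi> x))" and ?y = "(y, real_of_ereal (\<phi> y))"
  obtain z' v' where z': "z' \<longlonglongrightarrow> ?x" "\<And>k. z' k \<in> epi \<phi>" and v': "v' \<longlonglongrightarrow> (v, -1)"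
    "\<And>k. v' k \<in> regular_normal_cone (epi \<phi>) (z' k)"
    using v by (auto simp: subdifferential_def limiting_normal_cone_def)
  have "?y \<in> epi \<phi>"
    using y by (simp add: mem_epi_iff[where \<phi>=\<phi>, OF nm])
  then have "v' k \<bullet> (?y - z' k) \<le> 0" for k
    using regular_normal_cone_convex[OF convex_epi[OF nm conv] z'(2) _ v'(2)] by blast
  moreover have "(\<lambda>k. v' k \<bullet> (?y - z' k)) \<longlonglongrightarrow> (v, -1) \<bullet> (?y - ?x)"
    by (intro tendsto_intros z' v')
  ultimately have "(v, -1) \<bullet> (?y - ?x) \<le> 0"
    by (intro LIMSEQ_le_const2) auto
  then show ?thesis by simp
qed

text \<open>The implication from (i) to (ii). Adding two subgradient inequalities shows that the
  subdifferential is monotone; dividing by (t k)^2 gives the sign for the approximating directions,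
  and limits preserve it.\<close>

lemma convex_fun_graphical_derivative_psd:
  assumes nm: "\<And>x. \<phi> x \<noteq> -\<infinity>" and conv: "convex_fun \<phi>"
    and xv: "(x, v) \<in> gph_subdiff \<phi>"
  shows "pos_semidef_map (graphical_derivative \<phi> x v)"
  unfolding pos_semidef_map_def
proof (intro allI ballI)
  fix w z assume "z \<in> graphical_derivative \<phi> x v w"
  then obtain t p where t: "\<And>k. 0 < t k" and p: "p \<longlonglongrightarrow> (w, z)"
    and mem: "\<And>k::nat. (x, v) + t k *\<^sub>R p k \<in> gph_subdiff \<phi>"
    by (auto simp: graphical_derivative_def tangent_cone_def)
  have mono: "0 \<le> (b - v) \<bullet> (a - x)" if "(a, b) \<in> gph_subdiff \<phi>" for a b
  proof -
    have "v \<in> subdifferential \<phi> x" "b \<in> subdifferential \<phi> a"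
      using that xv by (auto simp: gph_subdiff_def)
    moreover from this have "x \<in> eff_dom \<phi>" "a \<in> eff_dom \<phi>"
      by (auto simp: subdifferential_def)
    ultimately have "v \<bullet> (a - x) + b \<bullet> (x - a) \<le> 0"
      using convex_fun_subgradient[OF nm conv, of v x a] convex_fun_subgradient[OF nm conv, of b a x] by simp
    then show ?thesis by (simp add: inner_simps)
  qed
  have "0 \<le> snd (p k) \<bullet> fst (p k)" for k
  proof -
    have "(x + t k *\<^sub>R fst (p k), v + t k *\<^sub>R snd (p k)) \<in> gph_subdiff \<phi>"
      using mem[of k] by (cases "p k") simp
    from mono[OF this] show ?thesis
      using t[of k] by (simp add: zero_le_mult_iff)
  qed
  moreover have "(\<lambda>k. snd (p k) \<bullet> fst (p k)) \<longlonglongrightarrow> snd (w, z) \<bullet> fst (w, z)"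
    by (intro tendsto_intros p)
  ultimately show "0 \<le> z \<bullet> w"
    by (auto intro: LIMSEQ_le_const)
qed

text \<open>A quadratic minorant touching at x bounds the numerator of the normal quotient by a
  multiple of the squared distance, so (v, -1) is even a regular normal. Constant sequences then
  make it a limiting one.\<close>

lemma proximal_subgradient:
  assumes nm: "\<And>x. \<phi> x \<noteq> -\<infinity>" and x: "x \<in> eff_dom \<phi>"
    and ineq: "\<And>y. y \<in> eff_dom \<phi> \<Longrightarrow>
      real_of_ereal (\<phi> x) + v \<bullet> (y - x) - c * (norm (y - x))\<^sup>2 \<le> real_of_ereal (\<phi> y)"
  shows "v \<in> subdifferential \<phi> x"
proof -
  let ?x = "(x, real_of_ereal (\<phi> x))"
  have xe: "?x \<in> epi \<phi>"
    using x by (simp add: mem_epi_iff[where \<phi>=\<phi>, OF nm])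
  have "(v, -1) \<in> regular_normal_cone (epi \<phi>) ?x"
    unfolding regular_normal_cone_def mem_Collect_eq Limsup_le_iff
  proof (intro allI impI)
    fix e :: ereal assume "e > 0"
    then obtain e' where e': "0 < ereal e'" "ereal e' < e"
      using ereal_dense2 by blast
    have "(v, -1) \<bullet> (p - ?x) / norm (p - ?x) \<le> \<bar>c\<bar> * norm (p - ?x)" if "p \<in> epi \<phi>" "p \<noteq> ?x" for p
    proof -
      obtain y \<alpha> where p: "p = (y, \<alpha>)" by (cases p)
      with that have y: "y \<in> eff_dom \<phi>" "real_of_ereal (\<phi> y) \<le> \<alpha>"
        by (auto simp: mem_epi_iff[where \<phi>=\<phi>, OF nm])
      have "(v, -1) \<bullet> (p - ?x) \<le> c * (norm (y - x))\<^sup>2"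
        using ineq[OF y(1)] y(2) by (simp add: p)
      also have "\<dots> \<le> \<bar>c\<bar> * (norm (p - ?x))\<^sup>2"
        using norm_fst_le[of "y - x" "\<alpha> - real_of_ereal (\<phi> x)"]
        by (intro mult_mono power_mono) (auto simp: p)
      finally show ?thesis
        using that(2) by (simp add: divide_le_eq power2_eq_square)
    qed
    moreover have "((\<lambda>p. \<bar>c\<bar> * norm (p - ?x)) \<longlongrightarrow> \<bar>c\<bar> * norm (?x - ?x)) (at ?x within epi \<phi>)"
      by (intro tendsto_intros)
    then have "\<forall>\<^sub>F p in at ?x within epi \<phi>. \<bar>c\<bar> * norm (p - ?x) < e'"
      using e'(1) by (intro order_tendstoD) auto
    moreover have "\<forall>\<^sub>F p in at ?x within epi \<phi>. p \<in> epi \<phi> \<and> p \<noteq> ?x"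
      by (auto simp: eventually_at_filter)
    ultimately show "\<forall>\<^sub>F p in at ?x within epi \<phi>. ereal ((v, -1) \<bullet> (p - ?x) / norm (p - ?x)) < e"
      by (smt (verit) eventually_elim2 e'(2) less_ereal.simps(1) less_trans order_le_less_trans)
  qed
  then have "(v, -1) \<in> limiting_normal_cone (epi \<phi>) ?x"
    unfolding limiting_normal_cone_def mem_Collect_eq using xe
    by (intro exI[of _ "\<lambda>_. ?x"] exI[of _ "\<lambda>_. (v, -1)"]) auto
  then show ?thesis
    using x by (simp add: subdifferential_def)
qed

section \<open>Second-order behaviour at the proximal graph points\<close>

locale prox_fun = prox_map "eff_dom \<phi>" "\<lambda>x. real_of_ereal (\<phi> x)" r \<sigma> P
  for \<phi> :: "'a::euclidean_space \<Rightarrow> ereal" and r \<sigma> P +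
  assumes not_MInf: "\<phi> x \<noteq> -\<infinity>"
begin

text \<open>Expanding |y - z|^2 about P z turns minimality of P z into a quadratic minorant of
  \<open>\<phi>\<close> that touches at P z with slope r (z - P z).\<close>

lemma graph_prox: "(P z, r *\<^sub>R (z - P z)) \<in> gph_subdiff \<phi>"
proof -
  have "real_of_ereal (\<phi> (P z)) + (r *\<^sub>R (z - P z)) \<bullet> (y - P z) - r / 2 * (norm (y - P z))\<^sup>2
      \<le> real_of_ereal (\<phi> y)" if "y \<in> eff_dom \<phi>" for y
  proof -
    have "r / 2 * (norm (y - z))\<^sup>2 = r / 2 * (norm (P z - z))\<^sup>2 + r / 2 * (norm (y - P z))\<^sup>2
        - (r *\<^sub>R (z - P z)) \<bullet> (y - P z)"
      unfolding power2_norm_eq_inner by (simp add: inner_simps inner_commute field_simps)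
    with envelope_le[OF that, of z] show ?thesis
      unfolding envelope_def by linarith
  qed
  then show ?thesis
    using proximal_subgradient[where \<phi>=\<phi>, OF not_MInf P_in] unfolding gph_subdiff_def by blast
qed

text \<open>The curve t -> (P (z + t h), r (z + t h - P (z + t h))) runs inside the graph, so its
  velocity at t = 0 is tangent to it.\<close>

lemma graphical_derivative_prox:
  assumes B: "(P has_derivative B) (at z)"
  shows "r *\<^sub>R (h - B h) \<in> graphical_derivative \<phi> (P z) (r *\<^sub>R (z - P z)) (B h)"
proof -
  define t where "t k = 1 / real (Suc k)" for k
  define u where "u k = (P (z + t k *\<^sub>R h) - P z) /\<^sub>R t k" for k
  have t: "0 < t k" for k by (simp add: t_def)
  have t0: "t \<longlonglongrightarrow> 0"
    unfolding t_def by (rule LIMSEQ_Suc[OF lim_const_over_n])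
  then have "filterlim t (at_right 0) sequentially"
    using t by (intro tendsto_imp_filterlim_at_right) auto
  then have u: "u \<longlonglongrightarrow> B h"
    unfolding u_def by (rule filterlim_compose[OF has_derivative_right_quotient[OF B]])
  have Pu: "P z + t k *\<^sub>R u k = P (z + t k *\<^sub>R h)" for k
    using t[of k] by (simp add: u_def)
  have "(P z, r *\<^sub>R (z - P z)) + t k *\<^sub>R (u k, r *\<^sub>R (h - u k)) \<in> gph_subdiff \<phi>" for k
  proof -
    have "r *\<^sub>R (z - P z) + t k *\<^sub>R r *\<^sub>R (h - u k) = r *\<^sub>R ((z + t k *\<^sub>R h) - (P z + t k *\<^sub>R u k))"
      by (simp add: algebra_simps)
    then show ?thesis
      using graph_prox[of "z + t k *\<^sub>R h"] by (simp add: Pu)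
  qed
  moreover have "(\<lambda>k. (u k, r *\<^sub>R (h - u k))) \<longlonglongrightarrow> (B h, r *\<^sub>R (h - B h))"
    by (intro tendsto_intros u)
  ultimately show ?thesis
    unfolding graphical_derivative_def tangent_cone_def mem_Collect_eq
    using t t0 by blast
qed

lemma derivative_nonexpansive:
  assumes B: "(P has_derivative B) (at z)"
    and psd: "pos_semidef_map (graphical_derivative \<phi> (P z) (r *\<^sub>R (z - P z)))"
  shows "norm (B h) \<le> norm h"
proof -
  have "0 \<le> (r *\<^sub>R (h - B h)) \<bullet> B h"
    using psd graphical_derivative_prox[OF B] unfolding pos_semidef_map_def by blast
  then have "(norm (B h))\<^sup>2 \<le> h \<bullet> B h"
    using r by (simp add: inner_diff_left zero_le_mult_iff power2_norm_eq_inner)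
  also have "\<dots> \<le> norm h * norm (B h)"
    by (rule norm_cauchy_schwarz)
  finally have "norm (B h) * norm (B h) \<le> norm (B h) * norm h"
    by (simp add: power2_eq_square mult.commute)
  then show ?thesis
    by (cases "norm (B h) = 0") auto
qed

definition envelope_quotient :: "'a \<Rightarrow> 'a \<Rightarrow> real \<Rightarrow> real" where
  "envelope_quotient z h t = (envelope (z + t *\<^sub>R h) - envelope z - t * (r * ((z - P z) \<bullet> h))) / (t\<^sup>2 / 2)"

text \<open>With y = P z + t u, the two sides differ exactly by the excess of f y + r / 2 |y - (z +
  t h)|^2 over the envelope at z + t h, divided by t^2 / 2. This is nonnegative, and zero when y is
  the minimizer P (z + t h).\<close>

lemma second_quotient_ge:
  assumes t: "t > 0"
  shows "ereal (envelope_quotient z h t - r * (norm (u - h))\<^sup>2)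
    \<le> second_quotient \<phi> (P z) (r *\<^sub>R (z - P z)) t u" (is ?ge)
    and "P z + t *\<^sub>R u = P (z + t *\<^sub>R h) \<Longrightarrow>
    second_quotient \<phi> (P z) (r *\<^sub>R (z - P z)) t u = ereal (envelope_quotient z h t - r * (norm (u - h))\<^sup>2)"
proof -
  let ?x = "P z" and ?v = "r *\<^sub>R (z - P z)" and ?y = "P z + t *\<^sub>R u"
  let ?f = "\<lambda>x. real_of_ereal (\<phi> x)"
  have dom: "second_quotient \<phi> ?x ?v t u = ereal ((?f ?y - ?f ?x - t * (?v \<bullet> u)) / (t\<^sup>2 / 2))"
    if yd: "?y \<in> eff_dom \<phi>"
  proof -
    obtain a b where "\<phi> ?y = ereal a" "\<phi> ?x = ereal b"
      using eff_dom_ereal[where \<phi>=\<phi>, OF not_MInf yd] eff_dom_ereal[where \<phi>=\<phi>, OF not_MInf P_in[of z]]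
      by blast
    then show ?thesis
      using t by (simp add: second_quotient_def)
  qed
  have id: "(?f ?y - ?f ?x - t * (?v \<bullet> u)) / (t\<^sup>2 / 2) = envelope_quotient z h t - r * (norm (u - h))\<^sup>2
      + (?f ?y + r / 2 * (norm (?y - (z + t *\<^sub>R h)))\<^sup>2 - envelope (z + t *\<^sub>R h)) / (t\<^sup>2 / 2)"
  proof -
    have eq: "?f ?y - ?f ?x - t * (?v \<bullet> u) = envelope (z + t *\<^sub>R h) - envelope z - t * (r * ((z - P z) \<bullet> h))
       - r * (norm (u - h))\<^sup>2 * (t\<^sup>2 / 2)
       + (?f ?y + r / 2 * (norm (?y - (z + t *\<^sub>R h)))\<^sup>2 - envelope (z + t *\<^sub>R h))"
      unfolding power2_norm_eq_inner envelope_def[of z]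
      by (simp add: inner_simps inner_commute power2_eq_square field_simps)
    have aux: "(a - b * q + c) / q = a / q - b + c / q" if "q \<noteq> 0" for a b c q :: real
      using that by (simp add: add_divide_distrib diff_divide_distrib)
    show ?thesis
      unfolding envelope_quotient_def eq by (rule aux) (use t in simp)
  qed
  show ?ge
  proof (cases "?y \<in> eff_dom \<phi>")
    case True
    have "0 \<le> (?f ?y + r / 2 * (norm (?y - (z + t *\<^sub>R h)))\<^sup>2 - envelope (z + t *\<^sub>R h)) / (t\<^sup>2 / 2)"
      using envelope_le[OF True, of "z + t *\<^sub>R h"] by simp
    then show ?thesis
      unfolding dom[OF True] id by simp
  next
    case False
    then have "\<phi> ?y = \<infinity>" by (rule not_eff_dom)
    moreover obtain a where "\<phi> ?x = ereal a"
      using eff_dom_ereal[where \<phi>=\<phi>, OF not_MInf P_in] by blast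
    ultimately have "second_quotient \<phi> ?x ?v t u = \<infinity>"
      using t by (simp add: second_quotient_def)
    then show ?thesis by simp
  qed
  assume y: "?y = P (z + t *\<^sub>R h)"
  then have "?y \<in> eff_dom \<phi>" by (simp add: P_in)
  from dom[OF this] show "second_quotient \<phi> ?x ?v t u = ereal (envelope_quotient z h t - r * (norm (u - h))\<^sup>2)"
    unfolding id by (simp add: y envelope_def[of "z + t *\<^sub>R h"])
qed

lemma envelope_quotient_tendsto:
  assumes "(P has_derivative B) (at z)"
  shows "((\<lambda>t. envelope_quotient z h t) \<longlongrightarrow> r * ((norm h)\<^sup>2 - B h \<bullet> h)) (at_right 0)"
  unfolding envelope_quotient_def by (rule envelope_second_order[OF assms])

lemma second_subderivative_ge:
  assumes B: "(P has_derivative B) (at z)"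
  shows "ereal (r * ((norm h)\<^sup>2 - B h \<bullet> h) - r * (norm (w - h))\<^sup>2)
    \<le> second_subderivative \<phi> (P z) (r *\<^sub>R (z - P z)) w"
proof -
  let ?F = "at_right (0::real) \<times>\<^sub>F nhds w"
  have nontriv: "?F \<noteq> bot"
    by (simp add: prod_filter_eq_bot trivial_limit_at_right_real)
  have "((\<lambda>p. envelope_quotient z h (fst p)) \<longlongrightarrow> r * ((norm h)\<^sup>2 - B h \<bullet> h)) ?F"
    by (rule filterlim_compose[OF envelope_quotient_tendsto[OF B] filterlim_fst])
  moreover have "(snd \<longlongrightarrow> w) ?F"
    by (rule filterlim_snd)
  ultimately have "((\<lambda>p. envelope_quotient z h (fst p) - r * (norm (snd p - h))\<^sup>2)
      \<longlongrightarrow> r * ((norm h)\<^sup>2 - B h \<bullet> h) - r * (norm (w - h))\<^sup>2) ?F"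
    by (intro tendsto_intros)
  then have "((\<lambda>p. ereal (envelope_quotient z h (fst p) - r * (norm (snd p - h))\<^sup>2))
      \<longlongrightarrow> ereal (r * ((norm h)\<^sup>2 - B h \<bullet> h) - r * (norm (w - h))\<^sup>2)) ?F"
    by (rule tendsto_ereal)
  from lim_imp_Liminf[OF nontriv this]
  have "ereal (r * ((norm h)\<^sup>2 - B h \<bullet> h) - r * (norm (w - h))\<^sup>2)
      = Liminf ?F (\<lambda>p. ereal (envelope_quotient z h (fst p) - r * (norm (snd p - h))\<^sup>2))" by simp
  also have "\<dots> \<le> Liminf ?F (\<lambda>(t, u). second_quotient \<phi> (P z) (r *\<^sub>R (z - P z)) t u)"
  proof (rule Liminf_mono)
    have "\<forall>\<^sub>F p in ?F. 0 < fst p"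
      by (rule eventually_compose_filterlim[OF _ filterlim_fst]) (rule eventually_at_right_less)
    then show "\<forall>\<^sub>F p in ?F. ereal (envelope_quotient z h (fst p) - r * (norm (snd p - h))\<^sup>2)
        \<le> (\<lambda>(t, u). second_quotient \<phi> (P z) (r *\<^sub>R (z - P z)) t u) p"
      by eventually_elim (auto simp: second_quotient_ge)
  qed
  finally show ?thesis by (simp add: second_subderivative_def)
qed

text \<open>The direction u t is chosen to give P z + t u t = P (z + t h), the equality case of
  \<open>second_quotient_ge\<close>.\<close>

lemma second_quotient_curve:
  fixes h
  assumes B: "(P has_derivative B) (at z)"
  defines "u t \<equiv> (P (z + t *\<^sub>R h) - P z) /\<^sub>R t"
  shows "(u \<longlongrightarrow> B h) (at_right 0)"
    "((\<lambda>t. second_quotient \<phi> (P z) (r *\<^sub>R (z - P z)) t (u t))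
      \<longlongrightarrow> ereal (r * (B h \<bullet> h - (norm (B h))\<^sup>2))) (at_right 0)"
proof -
  show u: "(u \<longlongrightarrow> B h) (at_right 0)"
    unfolding u_def by (rule has_derivative_right_quotient[OF B])
  have "((\<lambda>t. ereal (envelope_quotient z h t - r * (norm (u t - h))\<^sup>2))
      \<longlongrightarrow> ereal (r * ((norm h)\<^sup>2 - B h \<bullet> h) - r * (norm (B h - h))\<^sup>2)) (at_right 0)"
    by (intro tendsto_intros u envelope_quotient_tendsto[OF B])
  moreover have "\<forall>\<^sub>F t in at_right 0. ereal (envelope_quotient z h t - r * (norm (u t - h))\<^sup>2)
      = second_quotient \<phi> (P z) (r *\<^sub>R (z - P z)) t (u t)"
    using eventually_at_right_less[of 0]
    by eventually_elim (simp add: second_quotient_ge(2)[symmetric] u_def)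
  ultimately have "((\<lambda>t. second_quotient \<phi> (P z) (r *\<^sub>R (z - P z)) t (u t))
      \<longlongrightarrow> ereal (r * ((norm h)\<^sup>2 - B h \<bullet> h) - r * (norm (B h - h))\<^sup>2)) (at_right 0)"
    by (rule Lim_transform_eventually)
  moreover have "r * ((norm h)\<^sup>2 - B h \<bullet> h) - r * (norm (B h - h))\<^sup>2 = r * (B h \<bullet> h - (norm (B h))\<^sup>2)"
    unfolding power2_norm_eq_inner by (simp add: inner_simps inner_commute algebra_simps)
  ultimately show "((\<lambda>t. second_quotient \<phi> (P z) (r *\<^sub>R (z - P z)) t (u t))
      \<longlongrightarrow> ereal (r * (B h \<bullet> h - (norm (B h))\<^sup>2))) (at_right 0)"
    by simp
qed

text \<open>The lower bound from h, evaluated at w = B h, agrees with the limit along the curve,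
  because |h|^2 - <B h, h> - |B h - h|^2 = <B h, h> - |B h|^2.\<close>

lemma second_subderivative_range:
  assumes B: "(P has_derivative B) (at z)"
  shows "second_subderivative \<phi> (P z) (r *\<^sub>R (z - P z)) (B h) = ereal (r * (B h \<bullet> h - (norm (B h))\<^sup>2))"
proof (rule antisym)
  let ?u = "\<lambda>t. (P (z + t *\<^sub>R h) - P z) /\<^sub>R t"
  let ?q = "\<lambda>t u. second_quotient \<phi> (P z) (r *\<^sub>R (z - P z)) t u"
  show "second_subderivative \<phi> (P z) (r *\<^sub>R (z - P z)) (B h) \<le> ereal (r * (B h \<bullet> h - (norm (B h))\<^sup>2))"
  proof (rule ccontr)
    assume "\<not> ?thesis"
    from dense[OF this[unfolded not_le]] obtain c where c: "ereal (r * (B h \<bullet> h - (norm (B h))\<^sup>2)) < c"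
      "c < second_subderivative \<phi> (P z) (r *\<^sub>R (z - P z)) (B h)"
      by blast
    have "\<forall>\<^sub>F p in at_right 0 \<times>\<^sub>F nhds (B h). c < (\<lambda>(t, u). ?q t u) p"
      using c(2) unfolding second_subderivative_def by (rule less_LiminfD)
    moreover have "filterlim (\<lambda>t. (t, ?u t)) (at_right 0 \<times>\<^sub>F nhds (B h)) (at_right 0)"
      by (intro filterlim_Pair filterlim_ident second_quotient_curve[OF B])
    ultimately have "\<forall>\<^sub>F t in at_right 0. c < (\<lambda>(t, u). ?q t u) (t, ?u t)"
      by (rule eventually_compose_filterlim)
    then have "\<forall>\<^sub>F t in at_right 0. c < ?q t (?u t)"
      by (simp only: prod.case)
    moreover have "\<forall>\<^sub>F t in at_right 0. ?q t (?u t) < c"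
      by (rule order_tendstoD(2)[OF second_quotient_curve(2)[OF B] c(1)])
    ultimately have "\<forall>\<^sub>F t::real in at_right 0. False"
      by eventually_elim auto
    then show False by (simp add: trivial_limit_at_right_real)
  qed
  have "r * ((norm h)\<^sup>2 - B h \<bullet> h) - r * (norm (B h - h))\<^sup>2 = r * (B h \<bullet> h - (norm (B h))\<^sup>2)"
    unfolding power2_norm_eq_inner by (simp add: inner_simps inner_commute algebra_simps)
  with second_subderivative_ge[OF B, of h "B h"]
  show "ereal (r * (B h \<bullet> h - (norm (B h))\<^sup>2)) \<le> second_subderivative \<phi> (P z) (r *\<^sub>R (z - P z)) (B h)"
    by simp
qed

text \<open>The lower bound from an arbitrary k holds at the point B h, where the value is known. Comparing
  the two with k close to h gives the symmetry.\<close>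

lemma derivative_symmetric:
  assumes B: "(P has_derivative B) (at z)"
  shows "B h \<bullet> k = h \<bullet> B k"
proof -
  interpret B: bounded_linear B
    using B by (rule has_derivative_bounded_linear)
  have *: "2 * (B h \<bullet> k) - B k \<bullet> k \<le> B h \<bullet> h" for h k
  proof -
    have "r * ((norm k)\<^sup>2 - B k \<bullet> k) - r * (norm (B h - k))\<^sup>2 \<le> r * (B h \<bullet> h - (norm (B h))\<^sup>2)"
      using second_subderivative_ge[OF B, of k "B h"] by (simp add: second_subderivative_range[OF B])
    then have "r * ((norm k)\<^sup>2 - B k \<bullet> k - (norm (B h - k))\<^sup>2) \<le> r * (B h \<bullet> h - (norm (B h))\<^sup>2)"
      by (simp add: right_diff_distrib)
    then show ?thesis
      using r unfolding power2_norm_eq_inner by (simp add: inner_simps inner_commute)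
  qed
  have le: "B h \<bullet> k - B k \<bullet> h \<le> 0" for h k
  proof (rule tendsto_lowerbound)
    show "((\<lambda>s. s * (B k \<bullet> k)) \<longlongrightarrow> 0) (at_right 0)"
      by (auto intro!: tendsto_eq_intros)
    have "B h \<bullet> k - B k \<bullet> h \<le> s * (B k \<bullet> k)" if "0 < s" for s
    proof -
      have "s * (B h \<bullet> k - B k \<bullet> h) \<le> s * (s * (B k \<bullet> k))"
        using *[of h "h + s *\<^sub>R k"] by (simp add: B.add B.scaleR inner_simps algebra_simps)
      then show ?thesis using that by simp
    qed
    then show "\<forall>\<^sub>F s in at_right 0. B h \<bullet> k - B k \<bullet> h \<le> s * (B k \<bullet> k)"
      using eventually_at_right_less[of 0] by (auto elim: eventually_mono)
  qed auto
  show ?thesis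
    using le[of h k] le[of k h] by (simp add: inner_commute)
qed

text \<open>By symmetry, the component k of w orthogonal to the range lies in the kernel of B. The
  lower bound from h = s k is then r (2 s <w, k> - |w|^2), which is unbounded in s.\<close>

lemma second_subderivative_not_range:
  assumes B: "(P has_derivative B) (at z)" and w: "w \<notin> range B"
  shows "second_subderivative \<phi> (P z) (r *\<^sub>R (z - P z)) w = \<infinity>"
proof -
  interpret B: bounded_linear B
    using B by (rule has_derivative_bounded_linear)
  have sub: "subspace (range B)"
    using B.linear by (simp add: linear_subspace_image)
  obtain y k where yk: "y \<in> range B" "\<And>x. x \<in> range B \<Longrightarrow> orthogonal k x" "w = y + k"
    using orthogonal_subspace_decomp_exists[of "range B" w] unfolding span_eq_iff[THEN iffD2, OF sub]
    by blast
  have "norm (B k) = 0"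
    using yk(2)[of "B (B k)"] derivative_symmetric[OF B, of k "B k"] by (simp add: orthogonal_def)
  then have Bk: "B k = 0" by simp
  have "k \<noteq> 0" using yk w by auto
  have "w \<bullet> k = k \<bullet> k"
    using yk(2)[OF yk(1)] yk(3) by (simp add: inner_simps orthogonal_def inner_commute)
  then have pos: "w \<bullet> k > 0"
    using \<open>k \<noteq> 0\<close> by simp
  have "ereal c \<le> second_subderivative \<phi> (P z) (r *\<^sub>R (z - P z)) w" for c
  proof -
    \<comment> \<open>The solution of r (2 s <w, k> - |w|^2) = c.\<close>
    define s where "s = (c / r + (norm w)\<^sup>2) / (2 * (w \<bullet> k))"
    have "r * ((norm (s *\<^sub>R k))\<^sup>2 - B (s *\<^sub>R k) \<bullet> (s *\<^sub>R k)) - r * (norm (w - s *\<^sub>R k))\<^sup>2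
        = r * (s * (2 * (w \<bullet> k)) - (norm w)\<^sup>2)"
      unfolding power2_norm_eq_inner B.scaleR Bk by (simp add: inner_simps inner_commute algebra_simps)
    also have "\<dots> = c"
      using pos r by (simp add: s_def)
    finally show ?thesis
      using second_subderivative_ge[OF B, of "s *\<^sub>R k" w] by simp
  qed
  then show ?thesis by (rule ereal_top)
qed

text \<open>On the range of B the curve of proximal points is a recovery sequence. Off the range the
  lower limit is already infinite, so the constant sequence w suffices.\<close>

lemma twice_epi_differentiable_prox:
  assumes B: "(P has_derivative B) (at z)"
  shows "twice_epi_differentiable \<phi> (P z) (r *\<^sub>R (z - P z))"
  unfolding twice_epi_differentiable_def
proof (intro allI impI)
  fix w and \<tau> :: "nat \<Rightarrow> real" assume "(\<forall>k. 0 < \<tau> k) \<and> \<tau> \<longlonglongrightarrow> 0"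
  then have \<tau>: "filterlim \<tau> (at_right 0) sequentially"
    by (intro tendsto_imp_filterlim_at_right) auto
  let ?q = "\<lambda>t u. second_quotient \<phi> (P z) (r *\<^sub>R (z - P z)) t u"
  show "\<exists>w'. w' \<longlonglongrightarrow> w \<and> (\<lambda>k. ?q (\<tau> k) (w' k)) \<longlonglongrightarrow> second_subderivative \<phi> (P z) (r *\<^sub>R (z - P z)) w"
  proof (cases "w \<in> range B")
    case True
    then obtain h where h: "w = B h" by blast
    show ?thesis
      unfolding h second_subderivative_range[OF B]
      by (intro exI[of _ "\<lambda>k. (P (z + \<tau> k *\<^sub>R h) - P z) /\<^sub>R \<tau> k"] conjI
          filterlim_compose[OF second_quotient_curve(1)[OF B] \<tau>]
          filterlim_compose[OF second_quotient_curve(2)[OF B] \<tau>])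
  next
    case False
    have "(\<lambda>k. ?q (\<tau> k) w) \<longlonglongrightarrow> \<infinity>"
      unfolding tendsto_PInfty
    proof
      fix c
      have "ereal c < second_subderivative \<phi> (P z) (r *\<^sub>R (z - P z)) w"
        by (simp add: second_subderivative_not_range[OF B False])
      then have "\<forall>\<^sub>F p in at_right 0 \<times>\<^sub>F nhds w. ereal c < (\<lambda>(t, u). ?q t u) p"
        unfolding second_subderivative_def by (rule less_LiminfD)
      moreover have "filterlim (\<lambda>k. (\<tau> k, w)) (at_right 0 \<times>\<^sub>F nhds w) sequentially"
        by (intro filterlim_Pair \<tau> tendsto_const)
      ultimately have "\<forall>\<^sub>F k in sequentially. ereal c < (\<lambda>(t, u). ?q t u) (\<tau> k, w)"
        by (rule eventually_compose_filterlim)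
      then show "\<forall>\<^sub>F k in sequentially. ereal c < ?q (\<tau> k) w"
        by (simp only: prod.case)
    qed
    then show ?thesis
      unfolding second_subderivative_not_range[OF B False] by (intro exI[of _ "\<lambda>_. w"]) auto
  qed
qed

end

text \<open>Inserting h = g w, with g a right inverse of B on its range, into the value at B h gives
  r (<w, g w> - |w|^2). Averaging g with its adjoint leaves this form unchanged and makes the map a
  self-adjoint.\<close>

lemma (in prox_fun) generalized_quadratic_form_prox:
  fixes B :: "'a \<Rightarrow> 'a"
  assumes B: "(P has_derivative B) (at z)"
  obtains a where "linear a" "\<And>u w. a u \<bullet> w = u \<bullet> a w"
    "second_subderivative \<phi> (P z) (r *\<^sub>R (z - P z)) = (\<lambda>w. ereal (w \<bullet> a w) + indicator_fun (range B) w)"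
proof -
  have lB: "linear B"
    using B by (rule has_derivative_linear)
  obtain g where g: "linear g" "\<And>w. w \<in> range B \<Longrightarrow> B (g w) = w"
    using linear_exists_right_inverse_on[OF lB subspace_UNIV] by blast
  define a where "a w = (r / 2) *\<^sub>R (g w + adjoint g w) - r *\<^sub>R w" for w
  have "linear a"
    unfolding a_def by (intro linear_compose_sub linear_compose_scale_right linear_compose_add
        g adjoint_linear linear_ident)
  moreover have "a u \<bullet> w = u \<bullet> a w" for u w
    using adjoint_works[OF g(1), of u w] adjoint_works[OF g(1), of w u]
    by (simp add: a_def inner_simps inner_commute)
  moreover have "second_subderivative \<phi> (P z) (r *\<^sub>R (z - P z)) w = ereal (w \<bullet> a w) + indicator_fun (range B) w" for w
  proof (cases "w \<in> range B")
    case True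
    have "w \<bullet> a w = r * (w \<bullet> g w - (norm w)\<^sup>2)"
      using adjoint_works[OF g(1), of w w] unfolding power2_norm_eq_inner
      by (simp add: a_def inner_simps inner_commute algebra_simps)
    then show ?thesis
      using True second_subderivative_range[OF B, of "g w"] g(2)[OF True] by (simp add: indicator_fun_def)
  next
    case False
    then show ?thesis
      using second_subderivative_not_range[OF B] by (simp add: indicator_fun_def)
  qed
  ultimately show thesis
    by (rule that[OF _ _ ext])
qed

lemma generalized_twice_differentiable_prox:
  fixes \<phi> :: "real ^ 'n \<Rightarrow> ereal"
  assumes "prox_fun \<phi> r \<sigma> P" and B: "(P has_derivative B) (at z)"
  shows "generalized_twice_differentiable \<phi> (P z) (r *\<^sub>R (z - P z))"
proof -
  interpret prox_fun \<phi> r \<sigma> P by fact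
  obtain a where a: "linear a" "\<And>u w. a u \<bullet> w = u \<bullet> a w"
    "second_subderivative \<phi> (P z) (r *\<^sub>R (z - P z)) = (\<lambda>w. ereal (w \<bullet> a w) + indicator_fun (range B) w)"
    using generalized_quadratic_form_prox[OF B] by blast
  have "adjoint a = a"
    by (rule adjoint_unique) (simp add: a(2))
  then have "transpose (matrix a) = matrix a"
    using matrix_adjoint[OF a(1)] by simp
  moreover have "matrix a *v w = a w" for w
    using matrix_works[of a w] a(1) by simp
  moreover have "subspace (range B)"
    using has_derivative_linear[OF B] by (simp add: linear_subspace_image)
  ultimately have "generalized_quadratic_form (second_subderivative \<phi> (P z) (r *\<^sub>R (z - P z)))"
    unfolding generalized_quadratic_form_def a(3)
    by (intro exI[of _ "matrix a"] exI[of _ "range B"]) simp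
  then show ?thesis
    unfolding generalized_twice_differentiable_def using twice_epi_differentiable_prox[OF B] by blast
qed

section \<open>From proximal maps back to convexity\<close>

lemma prox_fun_exists:
  fixes \<phi> :: "'a::euclidean_space \<Rightarrow> ereal"
  assumes nm: "\<And>x. \<phi> x \<noteq> -\<infinity>" and proper: "proper_fun \<phi>" and lsc: "lower_semicontinuous \<phi>"
    and conv: "s_convex s \<phi>" and r: "0 < r" "0 < s + r"
  obtains P where "prox_fun \<phi> r (s + r) P"
proof -
  let ?f = "\<lambda>x. real_of_ereal (\<phi> x)"
  have "\<exists>p\<in>eff_dom \<phi>. \<forall>y\<in>eff_dom \<phi>. ?f p + r / 2 * (norm (p - z))\<^sup>2 + (s + r) / 2 * (norm (y - p))\<^sup>2
      \<le> ?f y + r / 2 * (norm (y - z))\<^sup>2" for z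
  proof -
    let ?G = "\<lambda>x. \<phi> x + ereal (r / 2 * (norm (x - z))\<^sup>2)"
    have nm': "?G x \<noteq> -\<infinity>" for x
      using nm[of x] by (cases "\<phi> x") auto
    have dom: "eff_dom ?G = eff_dom \<phi>"
      by (auto simp: eff_dom_def)
    have val: "real_of_ereal (?G x) = ?f x + r / 2 * (norm (x - z))\<^sup>2" if "x \<in> eff_dom \<phi>" for x
      using nm[of x] that by (cases "\<phi> x") (auto simp: eff_dom_def)
    have "proper_fun ?G"
      using proper unfolding proper_fun_def dom .
    moreover have "lower_semicontinuous ?G"
      by (intro lower_semicontinuous_add_continuous lsc continuous_intros)
    moreover have "s_convex (s + r) ?G"
      by (rule s_convex_add_square[OF nm conv])
    ultimately obtain p where "p \<in> eff_dom ?G" "\<And>y. y \<in> eff_dom ?G \<Longrightarrow>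
        real_of_ereal (?G p) + (s + r) / 2 * (norm (y - p))\<^sup>2 \<le> real_of_ereal (?G y)"
      using strongly_convex_attains_inf[where G="?G", OF nm'] r(2) by blast
    then show ?thesis
      unfolding dom using val by (intro bexI[of _ p] ballI) auto
  qed
  then obtain P where P: "\<And>z. P z \<in> eff_dom \<phi>" "\<And>z y. y \<in> eff_dom \<phi> \<Longrightarrow>
      ?f (P z) + r / 2 * (norm (P z - z))\<^sup>2 + (s + r) / 2 * (norm (y - P z))\<^sup>2 \<le> ?f y + r / 2 * (norm (y - z))\<^sup>2"
    by metis
  have "prox_fun \<phi> r (s + r) P"
    by unfold_locales (use P r nm in auto)
  then show thesis by (rule that)
qed

text \<open>The Moreau envelopes increase to \<^term>\<open>\<phi>\<close> as the parameter grows, so convexity passes to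
  the limit.\<close>

lemma convex_fun_if_envelopes_convex:
  fixes \<phi> :: "'a::euclidean_space \<Rightarrow> ereal"
  assumes nm: "\<And>x. \<phi> x \<noteq> -\<infinity>" and lsc: "lower_semicontinuous \<phi>"
    and env: "\<And>r. r > r0 \<Longrightarrow> \<exists>\<sigma> P. prox_fun \<phi> r \<sigma> P \<and> (\<forall>z d. (P (z + d) - P z) \<bullet> d \<le> (norm d)\<^sup>2)"
  shows "convex_fun \<phi>"
  unfolding convex_fun_def s_convex_iff_real[where \<phi>=\<phi>, OF nm]
proof (intro ballI)
  fix x y and l :: real
  let ?f = "\<lambda>x. real_of_ereal (\<phi> x)"
  assume x: "x \<in> eff_dom \<phi>" and y: "y \<in> eff_dom \<phi>" and l: "l \<in> {0<..<1}"
  define w where "w = (1 - l) *\<^sub>R x + l *\<^sub>R y"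
  define M where "M = (1 - l) * ?f x + l * ?f y"
  have "\<phi> w \<le> ereal M"
  proof (rule ccontr)
    assume "\<not> ?thesis"
    then have "ereal M < \<phi> w" by (simp add: not_le)
    \<comment> \<open>c is real even if \<open>\<phi>\<close> w is infinite, so the contradiction
      also proves that w belongs to the domain.\<close>
    then obtain c where c: "ereal M < ereal c" "ereal c < \<phi> w"
      using ereal_dense2 by blast
    have "open {x. ereal c < \<phi> x}"
      using lsc by (simp add: lower_semicontinuous_iff_open)
    then obtain \<delta> where \<delta>: "\<delta> > 0" "\<And>p. dist p w < \<delta> \<Longrightarrow> ereal c < \<phi> p"
      using c(2) by (auto simp: open_dist)
    obtain \<sigma>1 P1 where P1: "prox_fun \<phi> (r0 + 1) \<sigma>1 P1"
      using env[of "r0 + 1"] by auto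
    then interpret P1: prox_fun \<phi> "r0 + 1" \<sigma>1 P1 .
    \<comment> \<open>\<open>\<phi>\<close> may be unbounded below, so the envelope with parameter
      r0 + 1 serves as reference. If P w is at least \<open>\<delta>\<close> away from w, the extra
      penalty of parameter r over r0 + 1 is at least |c - P1.envelope w|, which lifts the new
      envelope to c.\<close>
    define r where "r = r0 + 1 + 2 * \<bar>c - P1.envelope w\<bar> / \<delta>\<^sup>2"
    have "r > r0" by (simp add: r_def add_pos_nonneg)
    then obtain \<sigma> P where P: "prox_fun \<phi> r \<sigma> P" and ne: "\<And>z d. (P (z + d) - P z) \<bullet> d \<le> (norm d)\<^sup>2"
      using env by blast
    from P interpret prox_fun \<phi> r \<sigma> P .
    have "c \<le> envelope w"
    proof (cases "dist (P w) w < \<delta>")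
      case True
      from \<delta>(2)[OF this] have "c < ?f (P w)"
        using not_MInf[of "P w"] P_in[of w] by (cases "\<phi> (P w)") (auto simp: eff_dom_def)
      moreover have "0 \<le> r / 2 * (norm (P w - w))\<^sup>2"
        using r by simp
      ultimately show ?thesis
        by (simp add: envelope_def)
    next
      case False
      then have "\<delta>\<^sup>2 \<le> (norm (P w - w))\<^sup>2"
        using \<delta>(1) by (intro power_mono) (auto simp: dist_norm)
      then have "2 * \<bar>c - P1.envelope w\<bar> / \<delta>\<^sup>2 * \<delta>\<^sup>2 \<le> 2 * \<bar>c - P1.envelope w\<bar> / \<delta>\<^sup>2 * (norm (P w - w))\<^sup>2"
        by (intro mult_left_mono) auto
      then have "2 * \<bar>c - P1.envelope w\<bar> \<le> (r - (r0 + 1)) * (norm (P w - w))\<^sup>2"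
        using \<delta>(1) by (simp add: r_def)
      then have "c - P1.envelope w \<le> (r - (r0 + 1)) * (norm (P w - w))\<^sup>2 / 2"
        using abs_ge_self[of "c - P1.envelope w"] by simp
      moreover have "P1.envelope w \<le> ?f (P w) + (r0 + 1) / 2 * (norm (P w - w))\<^sup>2"
        by (rule P1.envelope_le[OF P_in])
      moreover have "r / 2 * (norm (P w - w))\<^sup>2
          = (r0 + 1) / 2 * (norm (P w - w))\<^sup>2 + (r - (r0 + 1)) * (norm (P w - w))\<^sup>2 / 2"
        by (simp add: field_simps)
      ultimately show ?thesis
        unfolding envelope_def by linarith
    qed
    also have "\<dots> \<le> (1 - l) * envelope x + l * envelope y"
      unfolding w_def using l by (intro envelope_convex ne) auto
    also have "\<dots> \<le> M"
      unfolding M_def using l envelope_le_self[OF x] envelope_le_self[OF y]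
      by (intro add_mono mult_left_mono) auto
    finally show False
      using c(1) by simp
  qed
  then show "(1 - l) *\<^sub>R x + l *\<^sub>R y \<in> eff_dom \<phi> \<and> ?f ((1 - l) *\<^sub>R x + l *\<^sub>R y)
      \<le> (1 - l) * ?f x + l * ?f y - 0 / 2 * l * (1 - l) * (norm (x - y))\<^sup>2"
    unfolding w_def[symmetric] M_def[symmetric] using nm[of w]
    by (cases "\<phi> w") (auto simp: eff_dom_def)
qed

lemma convex_fun_if_psd:
  fixes \<phi> :: "real ^ 'n \<Rightarrow> ereal"
  assumes nm: "\<And>x. \<phi> x \<noteq> -\<infinity>" and proper: "proper_fun \<phi>" and lsc: "lower_semicontinuous \<phi>"
    and wc: "weakly_convex \<phi>"
    and psd: "\<And>x v. (x, v) \<in> gph_subdiff \<phi> \<Longrightarrow> generalized_twice_differentiable \<phi> x v \<Longrightarrow>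
      pos_semidef_map (graphical_derivative \<phi> x v)"
  shows "convex_fun \<phi>"
proof -
  obtain s where s: "s < 0" "s_convex s \<phi>"
    using wc by (auto simp: weakly_convex_def)
  show ?thesis
  proof (rule convex_fun_if_envelopes_convex[OF nm lsc])
    fix r assume r: "r > - s"
    then obtain P where P: "prox_fun \<phi> r (s + r) P"
      using prox_fun_exists[OF nm proper lsc s(2), of r] s(1) by auto
    interpret prox_fun \<phi> r "s + r" P by (rule P)
    \<comment> \<open>Valid at every point of differentiability; the exceptional null set enters
      only through Rademacher's theorem in \<open>prox_inner_le\<close>.\<close>
    have "norm (B h) \<le> norm h" if B: "(P has_derivative B) (at z)" for z B h
      by (rule derivative_nonexpansive[OF B psd[OF graph_prox generalized_twice_differentiable_prox[OF P B]]])
    then have "(P (z + d) - P z) \<bullet> d \<le> (norm d)\<^sup>2" for z d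
      by (intro prox_inner_le) auto
    with P show "\<exists>\<sigma> P. prox_fun \<phi> r \<sigma> P \<and> (\<forall>z d. (P (z + d) - P z) \<bullet> d \<le> (norm d)\<^sup>2)"
      by blast
  qed
qed

theorem corollary3p7:
  fixes \<phi> :: "real ^ 'n \<Rightarrow> ereal"
  assumes "\<And>x. \<phi> x \<noteq> -\<infinity>"
    and "proper_fun \<phi>"
    and "lower_semicontinuous \<phi>"
    and "weakly_convex \<phi>"
  shows "(convex_fun \<phi> \<longleftrightarrow>
           (\<forall>(x, v) \<in> gph_subdiff \<phi>. pos_semidef_map (graphical_derivative \<phi> x v)))
       \<and> (convex_fun \<phi> \<longleftrightarrow>
           (\<forall>(x, v) \<in> gph_subdiff \<phi>. twice_epi_differentiable \<phi> x v \<longrightarrow>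
              pos_semidef_map (graphical_derivative \<phi> x v)))
       \<and> (convex_fun \<phi> \<longleftrightarrow>
           (\<forall>(x, v) \<in> gph_subdiff \<phi>. generalized_twice_differentiable \<phi> x v \<longrightarrow>
              pos_semidef_map (graphical_derivative \<phi> x v)))"
proof -
  have "pos_semidef_map (graphical_derivative \<phi> x v)" if "convex_fun \<phi>" "(x, v) \<in> gph_subdiff \<phi>" for x v
    using convex_fun_graphical_derivative_psd[OF assms(1) that] .
  moreover have "convex_fun \<phi>"
    if "\<forall>(x, v) \<in> gph_subdiff \<phi>. generalized_twice_differentiable \<phi> x v \<longrightarrow>
      pos_semidef_map (graphical_derivative \<phi> x v)"
    using that by (intro convex_fun_if_psd[OF assms]) auto
  \<comment> \<open>The passages from (ii) to (iii) and from (iii) to (iv) only restrict the pairs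
    considered, since generalized twice differentiability includes twice
    epi-differentiability.\<close>
  ultimately show ?thesis
    unfolding generalized_twice_differentiable_def by blast
qed

end
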